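(* Let $\mathscr{H}$ be a finite dimensional complex Hilbert space, let $T, S\in\mathcal{C}_p$, and let $T = U|T|$, $S = V|S|$ be their polar decompositions. If $1<p<\infty$, then the following statements are equivalent: (i) $T\parallel S$ in the Schatten $p$-norm. (ii) $\|T\|_p\,\big|\mathrm{tr}(|T|^{p-1}U^*S)\big| = \|S\|_p\,\mathrm{tr}(|T|^p)$. (iii) $\|S\|_p\,\big|\mathrm{tr}(|S|^{p-1}V^*T)\big| = \|T\|_p\,\mathrm{tr}(|S|^p)$. The same equivalence is true for $p=1$ if $T, S\in\mathcal{C}_1$ are invertible.
   Context: For $1\le p<\infty$, $\mathcal{C}_p$ is the Schatten $p$-class of compact operators $T$ on $\mathscr{H}$ with $\mathrm{tr}(|T|^p)<\infty$, where $|T|=(T^*T)^{1/2}$ and $\mathrm{tr}$ is the usual trace; the Schatten $p$-norm is $\|T\|_p=(\mathrm{tr}(|T|^p))^{1/p}$. $T\parallel S$ in the Schatten $p$-norm (norm-parallel) means that $\|T+\lambda S\|_p=\|T\|_p+\|S\|_p$ for some $\lambda\in\mathbb{T}=\{\alpha\in\mathbb{C}:|\alpha|=1\}$. *)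

theory Defs
  imports "HOL-Analysis.Analysis"
begin

class complex_vector = ab_group_add +
  fixes scaleC :: "complex \<Rightarrow> 'a \<Rightarrow> 'a"  (infixr \<open>*\<^sub>C\<close> 75)
  assumes scaleC_add_right: "a *\<^sub>C (x + y) = a *\<^sub>C x + a *\<^sub>C y"
    and scaleC_add_left: "(a + b) *\<^sub>C x = a *\<^sub>C x + b *\<^sub>C x"
    and scaleC_scaleC: "a *\<^sub>C (b *\<^sub>C x) = (a * b) *\<^sub>C x"
    and scaleC_one: "1 *\<^sub>C x = x"

global_interpretation complex_vector: vector_space "scaleC :: complex \<Rightarrow> 'a \<Rightarrow> 'a::complex_vector"
  defines cspan = complex_vector.span
  by unfold_locales (simp_all add: scaleC_add_right scaleC_add_left scaleC_scaleC scaleC_one)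

text \<open>The inner product is linear in its first argument. By conjugate symmetry
  \<open>cinner x x\<close> is real, so positivity is a condition on its real part only.\<close>

class complex_inner = complex_vector +
  fixes cinner :: "'a \<Rightarrow> 'a \<Rightarrow> complex"
  assumes cinner_add_left: "cinner (x + y) z = cinner x z + cinner y z"
    and cinner_scaleC_left: "cinner (a *\<^sub>C x) y = a * cinner x y"
    and cinner_commute: "cinner y x = cnj (cinner x y)"
    and cinner_pos: "x \<noteq> 0 \<Longrightarrow> 0 < Re (cinner x x)"

text \<open>Completeness is automatic in finite dimension.\<close>

class fd_complex_hilbert = complex_inner +
  assumes finite_dim: "\<exists>B. finite B \<and> (\<forall>x. \<exists>c. x = (\<Sum>b\<in>B. c b *\<^sub>C b))"

lemma finite_dim_iff_span:
  fixes B :: "'a::complex_vector set"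
  assumes "finite B"
  shows "(\<forall>x. \<exists>c. x = (\<Sum>b\<in>B. c b *\<^sub>C b)) \<longleftrightarrow> cspan B = UNIV"
  unfolding complex_vector.span_finite[OF assms] by blast

instantiation complex :: complex_inner
begin

definition scaleC_complex :: "complex \<Rightarrow> complex \<Rightarrow> complex"
  where "scaleC_complex a x = a * x"

definition cinner_complex :: "complex \<Rightarrow> complex \<Rightarrow> complex"
  where "cinner_complex x y = x * cnj y"

instance
proof
  fix a b x y z :: complex
  show "a *\<^sub>C (x + y) = a *\<^sub>C x + a *\<^sub>C y" "(a + b) *\<^sub>C x = a *\<^sub>C x + b *\<^sub>C x"
    "a *\<^sub>C (b *\<^sub>C x) = (a * b) *\<^sub>C x" "1 *\<^sub>C x = x"
    by (simp_all add: scaleC_complex_def algebra_simps)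
  show "cinner (x + y) z = cinner x z + cinner y z"
    "cinner (a *\<^sub>C x) y = a * cinner x y" "cinner y x = cnj (cinner x y)"
    by (simp_all add: scaleC_complex_def cinner_complex_def algebra_simps)
  show "0 < Re (cinner x x)" if "x \<noteq> 0"
    using that by (simp add: cinner_complex_def complex_mult_cnj sum_power2_gt_zero_iff complex_eq_iff flip: power2_eq_square)
qed

end

instance complex :: fd_complex_hilbert
proof
  have "x \<in> cspan {1}" for x :: complex
    using complex_vector.span_scale[OF complex_vector.span_base[of "1::complex" "{1}"], of x]
    by (simp add: scaleC_complex_def)
  then show "\<exists>B::complex set. finite B \<and> (\<forall>x. \<exists>c. x = (\<Sum>b\<in>B. c b *\<^sub>C b))"
    using finite_dim_iff_span[of "{1::complex}"] by (intro exI[of _ "{1}"]) auto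
qed

instantiation vec :: (complex_inner, finite) complex_inner
begin

definition scaleC_vec :: "complex \<Rightarrow> 'a ^ 'b \<Rightarrow> 'a ^ 'b"
  where "scaleC_vec a x = (\<chi> i. a *\<^sub>C x $ i)"

definition cinner_vec :: "'a ^ 'b \<Rightarrow> 'a ^ 'b \<Rightarrow> complex"
  where "cinner_vec x y = (\<Sum>i\<in>UNIV. cinner (x $ i) (y $ i))"

instance
proof
  fix a b :: complex and x y z :: "'a ^ 'b"
  show "a *\<^sub>C (x + y) = a *\<^sub>C x + a *\<^sub>C y" "(a + b) *\<^sub>C x = a *\<^sub>C x + b *\<^sub>C x"
    "a *\<^sub>C (b *\<^sub>C x) = (a * b) *\<^sub>C x" "1 *\<^sub>C x = x"
    by (simp_all add: scaleC_vec_def vec_eq_iff scaleC_add_right scaleC_add_left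
        scaleC_scaleC scaleC_one)
  show "cinner (x + y) z = cinner x z + cinner y z"
    by (simp add: cinner_vec_def cinner_add_left sum.distrib)
  show "cinner (a *\<^sub>C x) y = a * cinner x y"
    by (simp add: cinner_vec_def scaleC_vec_def cinner_scaleC_left sum_distrib_left)
  show "cinner y x = cnj (cinner x y)"
    unfolding cinner_vec_def cnj_sum by (intro sum.cong refl cinner_commute)
  show "0 < Re (cinner x x)" if nz: "x \<noteq> 0"
  proof -
    obtain i where i: "x $ i \<noteq> 0"
      using nz by (auto simp: vec_eq_iff)
    have zero: "cinner 0 u = 0" for u :: 'a
      using cinner_add_left[of 0 0 u] by simp
    have "0 \<le> Re (cinner u u)" for u :: 'a
      using cinner_pos[of u] zero by (cases "u = 0") (auto intro: less_imp_le)
    then show ?thesis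
      unfolding cinner_vec_def Re_sum
      using i cinner_pos[OF i] by (intro sum_pos2[of _ i]) auto
  qed
qed

end

instance vec :: (fd_complex_hilbert, finite) fd_complex_hilbert
proof
  obtain B :: "'a set" where B: "finite B" "cspan B = UNIV"
    using finite_dim finite_dim_iff_span by blast
  define C where "C = (\<lambda>(i, b). axis i b :: 'a ^ 'b) ` (UNIV \<times> B)"
  have axis: "axis i u \<in> cspan C" for i u
  proof -
    have "u \<in> cspan B" using B by simp
    then show ?thesis
    proof (induction rule: complex_vector.span_induct_alt)
      case base
      have "axis i (0::'a) = (0 :: 'a ^ 'b)" by (simp add: axis_def vec_eq_iff)
      then show ?case using complex_vector.span_zero[of C] by metis
    next
      case (step c b v)
      have "axis i (c *\<^sub>C b + v) = c *\<^sub>C axis i b + (axis i v :: 'a ^ 'b)"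
        by (auto simp: axis_def vec_eq_iff scaleC_vec_def)
      moreover have "axis i b \<in> cspan C"
        using step by (intro complex_vector.span_base) (auto simp: C_def)
      ultimately show ?case
        using step by (simp add: complex_vector.span_add complex_vector.span_scale)
    qed
  qed
  have "x \<in> cspan C" for x
  proof -
    have "x = (\<Sum>i\<in>UNIV. axis i (x $ i))"
      by (simp add: vec_eq_iff axis_def)
    moreover have "\<dots> \<in> cspan C"
      using axis by (intro complex_vector.span_sum) auto
    ultimately show ?thesis by simp
  qed
  moreover have "finite C"
    using B by (simp add: C_def)
  ultimately show "\<exists>B::('a ^ 'b) set. finite B \<and> (\<forall>x. \<exists>c. x = (\<Sum>b\<in>B. c b *\<^sub>C b))"
    using finite_dim_iff_span[of C] by blast
qed

text \<open>In finite dimension every linear operator is compact and has finite trace, so the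
  Schatten class of every exponent \<open>p\<close> consists of all linear operators.\<close>

abbreviation clinear :: "('h::complex_vector \<Rightarrow> 'h) \<Rightarrow> bool"
  where "clinear \<equiv> Vector_Spaces.linear scaleC scaleC"

definition cnorm :: "'h::complex_inner \<Rightarrow> real"
  where "cnorm x = sqrt (Re (cinner x x))"

definition cadjoint :: "('h::fd_complex_hilbert \<Rightarrow> 'h) \<Rightarrow> 'h \<Rightarrow> 'h"
  where "cadjoint T = (THE A. \<forall>x y. cinner (T x) y = cinner x (A y))"

definition orthonormal_basis :: "'h::fd_complex_hilbert set \<Rightarrow> bool"
  where "orthonormal_basis B \<longleftrightarrow>
    (\<forall>x\<in>B. \<forall>y\<in>B. cinner x y = (if x = y then 1 else 0)) \<and> cspan B = UNIV"

definition ctrace :: "('h::fd_complex_hilbert \<Rightarrow> 'h) \<Rightarrow> complex"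
  where "ctrace T = (\<Sum>e\<in>(SOME B. orthonormal_basis B). cinner (T e) e)"

text \<open>The real power of a positive operator by functional calculus: \<open>A\<close> is diagonalizable
  with nonnegative real eigenvalues, and \<open>A\<^sup>r\<close> is the operator acting as \<open>a\<^sup>r\<close> on the
  eigenspace of \<open>A\<close> for the eigenvalue \<open>a\<close>. As \<open>0 powr 0 = 0\<close>, the zeroth power is the
  identity only if \<open>A\<close> is invertible.\<close>

definition op_powr :: "('h::fd_complex_hilbert \<Rightarrow> 'h) \<Rightarrow> real \<Rightarrow> 'h \<Rightarrow> 'h"
  where "op_powr A r = (THE B. clinear B \<and>
    (\<forall>(a::real) v. A v = complex_of_real a *\<^sub>C v \<longrightarrow> B v = complex_of_real (a powr r) *\<^sub>C v))"

definition op_abs :: "('h::fd_complex_hilbert \<Rightarrow> 'h) \<Rightarrow> 'h \<Rightarrow> 'h"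
  where "op_abs T = op_powr (cadjoint T \<circ> T) (1/2)"

definition partial_isometry :: "('h::fd_complex_hilbert \<Rightarrow> 'h) \<Rightarrow> bool"
  where "partial_isometry U \<longleftrightarrow> clinear U \<and>
    (\<forall>x. (\<forall>y. U y = 0 \<longrightarrow> cinner x y = 0) \<longrightarrow> cnorm (U x) = cnorm x)"

definition polar_decomposition :: "('h::fd_complex_hilbert \<Rightarrow> 'h) \<Rightarrow> ('h \<Rightarrow> 'h) \<Rightarrow> bool"
  where "polar_decomposition T U \<longleftrightarrow>
    partial_isometry U \<and> (\<forall>x. U x = 0 \<longleftrightarrow> T x = 0) \<and> T = U \<circ> op_abs T"

text \<open>The trace of \<open>|T|\<^sup>p\<close> is a nonnegative real number.\<close>

definition schatten_norm :: "real \<Rightarrow> ('h::fd_complex_hilbert \<Rightarrow> 'h) \<Rightarrow> real"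
  where "schatten_norm p T = (Re (ctrace (op_powr (op_abs T) p))) powr (1/p)"

definition schatten_parallel :: "real \<Rightarrow> ('h::fd_complex_hilbert \<Rightarrow> 'h) \<Rightarrow> ('h \<Rightarrow> 'h) \<Rightarrow> bool"
  where "schatten_parallel p T S \<longleftrightarrow>
    (\<exists>c::complex. cmod c = 1 \<and>
      schatten_norm p (\<lambda>x. T x + c *\<^sub>C S x) = schatten_norm p T + schatten_norm p S)"

end

theory Submission
  imports Defs "HOL-Computational_Algebra.Fundamental_Theorem_Algebra"
begin

text \<open>Conditions (ii) and (iii) arise from each other by exchanging \<open>T\<close> and \<open>S\<close>, and the relation
  in (i) is symmetric, so the equivalence of (i) and (ii) suffices. Write \<open>D(T, S)\<close> for
  \<open>tr (|T|\<^bsup>p-1\<^esup> U\<^sup>*S)\<close>. It is linear in \<open>S\<close>, \<open>D(T, T) = \<parallel>T\<parallel>\<^sup>p\<close>, and Hoelder's inequality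
  \<open>|D(T, S)| \<le> \<parallel>T\<parallel>\<^bsup>p-1\<^esup> \<parallel>S\<parallel>\<close> holds. All conditions are true if \<open>T = 0\<close>; otherwise (ii) says that equality occurs in it.

  If it does, rotate \<open>S\<close> by a unimodular \<open>c\<close> so that \<open>D(T, c S)\<close> is nonnegative. Then
  \<open>\<parallel>T\<parallel>\<^bsup>p-1\<^esup> (\<parallel>T\<parallel> + \<parallel>S\<parallel>) = D(T, T + c S) \<le> \<parallel>T\<parallel>\<^bsup>p-1\<^esup> \<parallel>T + c S\<parallel>\<close>, which is (i). Conversely, let
  \<open>R = T + c S\<close> have norm \<open>\<parallel>T\<parallel> + \<parallel>S\<parallel>\<close>. Since \<open>\<parallel>R\<parallel>\<^sup>p = D(R, T) + D(R, c S)\<close>, Hoelder's inequality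
  is an equality for both summands. For \<open>p > 1\<close> equality means, for nonzero operators, that they are
  positive multiples of each other, so \<open>c S\<close> is a multiple of \<open>T\<close> and (ii) is immediate. For \<open>p = 1\<close> it
  means, if \<open>T\<close> is injective, that \<open>T\<close> and \<open>R\<close> have the same polar factor; hence
  \<open>D(T, S) = D(R, S)\<close> and (ii) follows again.

  The heart of the matter is therefore Hoelder's inequality with its equality case. After scaling,
  it is Young's inequality \<open>Re D(T, S) \<le> (p-1)/p \<parallel>T\<parallel>\<^sup>p + 1/p \<parallel>S\<parallel>\<^sup>p\<close>. To see this, take bases
  \<open>e\<close> and \<open>g\<close> of right singular vectors of \<open>T\<close> and \<open>S\<close>, with singular values \<open>t\<close> and \<open>s\<close> and left
  singular vectors \<open>f\<close> and \<open>h\<close>. Then \<open>D(T, S)\<close> is the double sum of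
  \<open>t\<^bsup>p-1\<^esup> s \<langle>e, g\<rangle> \<langle>h, f\<rangle>\<close>. The real part of \<open>\<langle>e, g\<rangle> \<langle>h, f\<rangle>\<close> is at most
  \<open>(|\<langle>e, g\<rangle>|\<^sup>2 + |\<langle>h, f\<rangle>|\<^sup>2) / 2\<close>, these numbers form a doubly substochastic matrix by the
  theorems of Parseval and Bessel, and the inequality for numbers
  \<open>t\<^bsup>p-1\<^esup> s \<le> (p-1)/p t\<^sup>p + 1/p s\<^sup>p\<close> does the rest (\<open>trace_young\<close>). As every single term has to be
  an equality, the case of equality can be read off (\<open>trace_young_eq\<close>).

  Singular bases exist by the spectral theorem for \<open>T\<^sup>*T\<close>, which is derived from the fundamental
  theorem of algebra (\<open>selfadjoint_eigenbasis\<close>). In such a basis the powers of \<open>|T|\<close> are diagonal,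
  which turns norms and traces into sums over singular values.\<close>

section \<open>Linear operators\<close>

lemma clinear_add: "clinear A \<Longrightarrow> A (x + y) = A x + A y"
  by (simp add: Vector_Spaces.linear_iff)

lemma clinear_scaleC: "clinear A \<Longrightarrow> A (c *\<^sub>C x) = c *\<^sub>C A x"
  by (simp add: Vector_Spaces.linear_iff)

lemma clinearI:
  assumes "\<And>x y. A (x + y) = A x + A y" and "\<And>c x. A (c *\<^sub>C x) = c *\<^sub>C A x"
  shows "clinear A"
  using assms by (simp add: Vector_Spaces.linear_iff complex_vector.vector_space_axioms)

lemma clinear_zero: "clinear A \<Longrightarrow> A 0 = 0"
  using clinear_add[of A 0 0] by simp

lemma clinear_sum:
  assumes "clinear A"
  shows "A (\<Sum>i\<in>I. f i) = (\<Sum>i\<in>I. A (f i))"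
  by (induction I rule: infinite_finite_induct)
    (auto simp: clinear_add[OF assms] clinear_zero[OF assms])

lemma clinear_comp:
  assumes "clinear A" "clinear B"
  shows "clinear (A \<circ> B)"
  by (intro clinearI)
    (auto simp: clinear_add[OF assms(1)] clinear_add[OF assms(2)]
      clinear_scaleC[OF assms(1)] clinear_scaleC[OF assms(2)])

lemma clinear_add_scaleC:
  assumes "clinear A" "clinear B"
  shows "clinear (\<lambda>x. A x + c *\<^sub>C B x)"
  by (intro clinearI)
    (auto simp: clinear_add[OF assms(1)] clinear_add[OF assms(2)] clinear_scaleC[OF assms(1)]
      clinear_scaleC[OF assms(2)] scaleC_add_right scaleC_scaleC mult.commute)

lemma clinear_scaled:
  assumes "clinear A"
  shows "clinear (\<lambda>x. c *\<^sub>C A x)"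
  by (intro clinearI)
    (auto simp: clinear_add[OF assms] clinear_scaleC[OF assms] scaleC_add_right scaleC_scaleC mult.commute)

section \<open>Complex inner products\<close>

lemma cinner_zero_left [simp]: "cinner 0 y = 0"
  using cinner_add_left[of 0 0 y] by simp

lemma cinner_zero_right [simp]: "cinner x 0 = 0"
  using cinner_commute[of x 0] by simp

lemma cinner_add_right: "cinner x (y + z) = cinner x y + cinner x z"
  by (metis cinner_add_left cinner_commute complex_cnj_add)

lemma cinner_scaleC_right: "cinner x (a *\<^sub>C y) = cnj a * cinner x y"
  by (metis cinner_scaleC_left cinner_commute complex_cnj_mult)

lemma cinner_diff_left: "cinner (x - y) z = cinner x z - cinner y z"
  using cinner_add_left[of "x - y" y z] by simp

lemma cinner_diff_right: "cinner x (y - z) = cinner x y - cinner x z"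
  using cinner_add_right[of x "y - z" z] by simp

lemma cinner_sum_left: "cinner (\<Sum>i\<in>I. f i) y = (\<Sum>i\<in>I. cinner (f i) y)"
  by (induction I rule: infinite_finite_induct) (auto simp: cinner_add_left)

lemma cinner_sum_right: "cinner x (\<Sum>i\<in>I. f i) = (\<Sum>i\<in>I. cinner x (f i))"
  by (induction I rule: infinite_finite_induct) (auto simp: cinner_add_right)

lemma cinner_ext: "(\<And>z. cinner x z = cinner y z) \<Longrightarrow> x = y"
  using cinner_pos[of "x - y"] by (fastforce simp: cinner_diff_left)

lemma cinner_ext_right: "(\<And>z. cinner z x = cinner z y) \<Longrightarrow> x = y"
  using cinner_ext[of x y] cinner_commute[of _ x] cinner_commute[of _ y] by simp

lemma Re_cinner_self_nonneg: "0 \<le> Re (cinner x x)"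
  using cinner_pos[of x] by (cases "x = 0") auto

lemma cinner_self: "cinner x x = complex_of_real ((cnorm x)\<^sup>2)"
proof -
  have "Im (cinner x x) = 0"
    using arg_cong[OF cinner_commute[of x x], of Im] by simp
  then show ?thesis
    by (simp add: cnorm_def complex_eq_iff Re_cinner_self_nonneg)
qed

lemma cnorm_nonneg [simp]: "0 \<le> cnorm x"
  by (simp add: cnorm_def Re_cinner_self_nonneg)

lemma cnorm_eq_0_iff [simp]: "cnorm x = 0 \<longleftrightarrow> x = 0"
  using cinner_pos[of x] by (cases "x = 0") (auto simp: cnorm_def)

lemma cnorm_zero [simp]: "cnorm 0 = 0"
  by simp

lemma cnorm_scaleC: "cnorm (a *\<^sub>C x) = cmod a * cnorm x"
proof -
  have "complex_of_real ((cnorm (a *\<^sub>C x))\<^sup>2) = (a * cnj a) * complex_of_real ((cnorm x)\<^sup>2)"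
    by (simp only: cinner_self[symmetric] cinner_scaleC_left cinner_scaleC_right mult_ac)
  also have "\<dots> = complex_of_real ((cmod a * cnorm x)\<^sup>2)"
    by (simp add: complex_norm_square power_mult_distrib flip: of_real_power)
  finally have "(cnorm (a *\<^sub>C x))\<^sup>2 = (cmod a * cnorm x)\<^sup>2"
    using of_real_eq_iff by blast
  then show ?thesis by (simp add: power2_eq_iff_nonneg)
qed

lemma cnorm_diff_square: "(cnorm (x - y))\<^sup>2 = (cnorm x)\<^sup>2 + (cnorm y)\<^sup>2 - 2 * Re (cinner x y)"
proof -
  have "complex_of_real ((cnorm (x - y))\<^sup>2)
      = complex_of_real ((cnorm x)\<^sup>2) + complex_of_real ((cnorm y)\<^sup>2)
        - (cinner x y + cnj (cinner x y))"
    unfolding cinner_self[symmetric]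
    by (simp add: cinner_diff_left cinner_diff_right cinner_commute[of x y])
  from arg_cong[OF this, of Re] show ?thesis by simp
qed

section \<open>Orthonormal bases\<close>

definition orthonormal :: "'h::complex_inner set \<Rightarrow> bool"
  where "orthonormal E \<longleftrightarrow> (\<forall>x\<in>E. \<forall>y\<in>E. cinner x y = (if x = y then 1 else 0))"

lemma orthonormal_basis_iff: "orthonormal_basis E \<longleftrightarrow> orthonormal E \<and> cspan E = UNIV"
  by (simp add: orthonormal_basis_def orthonormal_def)

lemma cinner_orthonormal_combination:
  assumes "orthonormal E" "finite F" "F \<subseteq> E" "e \<in> F"
  shows "cinner (\<Sum>x\<in>F. c x *\<^sub>C x) e = c e"
proof -
  have "cinner (\<Sum>x\<in>F. c x *\<^sub>C x) e = (\<Sum>x\<in>F. if x = e then c x else 0)"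
    unfolding cinner_sum_left cinner_scaleC_left using assms
    by (intro sum.cong) (auto simp: orthonormal_def subset_iff)
  also have "\<dots> = c e" using assms by simp
  finally show ?thesis .
qed

lemma orthonormal_independent:
  assumes "orthonormal E"
  shows "complex_vector.independent E"
  unfolding complex_vector.independent_explicit_finite_subsets
proof (intro allI impI ballI)
  fix F u v
  assume *: "F \<subseteq> E" "finite F" "(\<Sum>v\<in>F. u v *\<^sub>C v) = 0" "v \<in> F"
  show "u v = 0"
    using cinner_orthonormal_combination[OF assms *(2,1,4), of u] *(3) by simp
qed

lemma orthonormal_finite_card:
  fixes E B :: "'h::fd_complex_hilbert set"
  assumes "orthonormal E" "finite B" "cspan B = UNIV"
  shows "finite E \<and> card E \<le> card B"
  using complex_vector.independent_span_bound[OF assms(2) orthonormal_independent[OF assms(1)]] assms(3)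
  by simp

lemma finite_spanning_set:
  obtains B :: "'h::fd_complex_hilbert set" where "finite B" "cspan B = UNIV"
proof -
  obtain B :: "'h set" where "finite B" "\<forall>x. \<exists>c. x = (\<Sum>b\<in>B. c b *\<^sub>C b)"
    using finite_dim by metis
  then show ?thesis using that finite_dim_iff_span[of B] by simp
qed

lemma orthonormal_finite:
  fixes E :: "'h::fd_complex_hilbert set"
  assumes "orthonormal E"
  shows "finite E"
  using orthonormal_finite_card[OF assms] finite_spanning_set[where 'h = 'h] by metis

lemma orthonormal_basis_finite: "orthonormal_basis E \<Longrightarrow> finite E"
  using orthonormal_finite orthonormal_basis_iff by blast

lemma orthonormal_basis_expansion:
  assumes "orthonormal_basis E"
  shows "x = (\<Sum>e\<in>E. cinner x e *\<^sub>C e)"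
proof -
  have E: "orthonormal E" "finite E" "cspan E = UNIV"
    using assms orthonormal_basis_finite orthonormal_basis_iff by blast+
  obtain c where c: "x = (\<Sum>e\<in>E. c e *\<^sub>C e)"
    using finite_dim_iff_span[OF E(2)] E(3) by metis
  have "c e = cinner x e" if "e \<in> E" for e
    using cinner_orthonormal_combination[OF E(1,2) subset_refl that, of c] c by simp
  then have "(\<Sum>e\<in>E. c e *\<^sub>C e) = (\<Sum>e\<in>E. cinner x e *\<^sub>C e)" by (intro sum.cong) simp_all
  with c show ?thesis by (rule trans)
qed

lemma parseval_cinner:
  assumes "orthonormal_basis E"
  shows "cinner x y = (\<Sum>e\<in>E. cinner x e * cinner e y)"
  by (subst orthonormal_basis_expansion[OF assms, of x]) (simp add: cinner_sum_left cinner_scaleC_left)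

lemma parseval_cnorm:
  assumes "orthonormal_basis E"
  shows "(\<Sum>e\<in>E. (cmod (cinner x e))\<^sup>2) = (cnorm x)\<^sup>2"
proof -
  have "cinner x x = (\<Sum>e\<in>E. complex_of_real ((cmod (cinner x e))\<^sup>2))"
    unfolding parseval_cinner[OF assms, of x x]
    by (intro sum.cong refl) (metis cinner_commute complex_norm_square of_real_power)
  then show ?thesis
    unfolding cinner_self of_real_sum[symmetric] using of_real_eq_iff by metis
qed

lemma clinear_basis_expansion:
  assumes "orthonormal_basis E" "clinear A"
  shows "A x = (\<Sum>e\<in>E. cinner x e *\<^sub>C A e)"
  by (subst orthonormal_basis_expansion[OF assms(1), of x])
    (simp add: clinear_sum[OF assms(2)] clinear_scaleC[OF assms(2)])

lemma clinear_eq_on_basis: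
  assumes "orthonormal_basis E" "clinear A" "clinear B" "\<And>e. e \<in> E \<Longrightarrow> A e = B e"
  shows "A x = B x"
  using assms clinear_basis_expansion[of E A x] clinear_basis_expansion[of E B x] by simp

text \<open>The sum is \<open>tr (B\<^sup>*A)\<close>: expanding each \<open>f\<close> over \<open>E\<close>, exchanging the sums and recognising the
  expansion of \<open>B e\<close> along \<open>F\<close> turns one basis into the other. Taking \<open>B\<close> to be the identity frees
  the trace from the basis chosen in its definition.\<close>

lemma sum_cinner_basis_independent:
  assumes "orthonormal_basis E" "orthonormal_basis F" "clinear A" "clinear B"
  shows "(\<Sum>e\<in>E. cinner (A e) (B e)) = (\<Sum>f\<in>F. cinner (A f) (B f))"
proof -
  have "(\<Sum>f\<in>F. cinner (A f) (B f)) = (\<Sum>f\<in>F. \<Sum>e\<in>E. cinner f e * cinner (A e) (B f))"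
    by (intro sum.cong refl, subst clinear_basis_expansion[OF assms(1,3)])
      (simp add: cinner_sum_left cinner_scaleC_left)
  also have "\<dots> = (\<Sum>e\<in>E. \<Sum>f\<in>F. cinner f e * cinner (A e) (B f))"
    by (rule sum.swap)
  also have "\<dots> = (\<Sum>e\<in>E. cinner (A e) (B e))"
  proof (intro sum.cong refl)
    fix e
    show "(\<Sum>f\<in>F. cinner f e * cinner (A e) (B f)) = cinner (A e) (B e)"
      by (subst (2) clinear_basis_expansion[OF assms(2,4)])
        (simp add: cinner_sum_right cinner_scaleC_right cinner_commute[of _ e, symmetric])
  qed
  finally show ?thesis by simp
qed

lemma ctrace_basis:
  assumes "orthonormal_basis E" "clinear A"
  shows "ctrace A = (\<Sum>e\<in>E. cinner (A e) e)"
proof -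
  have "orthonormal_basis (SOME B :: 'a set. orthonormal_basis B)"
    using assms(1) by (rule someI)
  moreover have "clinear (\<lambda>x::'a. x)" by (intro clinearI) auto
  ultimately show ?thesis
    unfolding ctrace_def using assms sum_cinner_basis_independent[of _ E A "\<lambda>x. x"] by blast
qed

section \<open>The spectral theorem for self-adjoint operators\<close>

text \<open>More iterates \<open>A\<^sup>k v\<close> than a finite spanning set has elements cannot be independent. If two of
  them coincide, their difference is already a nontrivial relation.\<close>

lemma krylov_dependent:
  fixes A :: "'h::fd_complex_hilbert \<Rightarrow> 'h"
  obtains n c i where "i \<le> n" "c i \<noteq> 0" "(\<Sum>k\<le>n. c k *\<^sub>C (A ^^ k) v) = 0"
proof -
  obtain B :: "'h set" where B: "finite B" "cspan B = UNIV"
    by (rule finite_spanning_set)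
  define n where "n = card B"
  define f where "f = (\<lambda>k. (A ^^ k) v)"
  show ?thesis
  proof (cases "inj_on f {..n}")
    case True
    have "complex_vector.dependent (f ` {..n})"
    proof (rule ccontr)
      assume "\<not> ?thesis"
      then have "card (f ` {..n}) \<le> card B"
        using complex_vector.independent_span_bound[OF B(1)] B(2) by blast
      then show False using card_image[OF True] n_def by simp
    qed
    then obtain u w where u: "w \<in> f ` {..n}" "u w \<noteq> 0" "(\<Sum>x\<in>f ` {..n}. u x *\<^sub>C x) = 0"
      unfolding complex_vector.dependent_finite[OF finite_imageI[OF finite_atMost]] by blast
    then obtain i where "i \<le> n" "w = f i" by auto
    moreover have "(\<Sum>k\<le>n. u (f k) *\<^sub>C (A ^^ k) v) = 0"
      using u(3) unfolding sum.reindex[OF True] by (simp add: f_def)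
    ultimately show ?thesis using that[of i n "u \<circ> f"] u(2) by simp
  next
    case False
    then obtain i j where ij: "i \<le> n" "j \<le> n" "i \<noteq> j" "f i = f j"
      by (auto simp: inj_on_def)
    \<comment> \<open>the relation \<open>A\<^sup>i v - A\<^sup>j v = 0\<close>\<close>
    define c where "c k = (if k = i then 1 else 0) - (if k = j then 1 else (0::complex))" for k
    have "(\<Sum>k\<le>n. c k *\<^sub>C f k)
        = (\<Sum>k\<le>n. (if k = i then f k else 0) - (if k = j then f k else 0))"
      using ij by (intro sum.cong) (auto simp: c_def complex_vector.scale_minus_left scaleC_one)
    also have "\<dots> = 0"
      using ij by (simp add: sum_subtractf)
    finally show ?thesis
      using that[of i n c] ij by (simp add: c_def f_def)
  qed
qed

definition poly_apply :: "complex poly \<Rightarrow> ('h::complex_vector \<Rightarrow> 'h) \<Rightarrow> 'h \<Rightarrow> 'h"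
  where "poly_apply q A v = (\<Sum>k\<le>degree q. coeff q k *\<^sub>C (A ^^ k) v)"

lemma poly_apply_altdef:
  assumes "degree q \<le> n"
  shows "poly_apply q A v = (\<Sum>k\<le>n. coeff q k *\<^sub>C (A ^^ k) v)"
  unfolding poly_apply_def using assms
  by (intro sum.mono_neutral_left) (auto simp: coeff_eq_0)

lemma poly_apply_linear_factor:
  fixes A :: "'h::complex_vector \<Rightarrow> 'h"
  assumes "clinear A"
  shows "poly_apply ([:- z, 1:] * q) A v = A (poly_apply q A v) - z *\<^sub>C poly_apply q A v"
proof -
  define n where "n = degree q"
  have eq: "[:- z, 1:] * q = pCons 0 q - smult z q"
    by simp
  have deg: "degree ([:- z, 1:] * q) \<le> Suc n"
    using degree_mult_le[of "[:- z, 1:]" q] by (simp add: n_def)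
  have "poly_apply ([:- z, 1:] * q) A v
      = (\<Sum>k\<le>Suc n. coeff (pCons 0 q) k *\<^sub>C (A ^^ k) v - (z * coeff q k) *\<^sub>C (A ^^ k) v)"
    unfolding poly_apply_altdef[OF deg] unfolding eq
    by (simp add: complex_vector.scale_left_diff_distrib)
  also have "\<dots> = (\<Sum>k\<le>n. coeff q k *\<^sub>C A ((A ^^ k) v)) - (\<Sum>k\<le>Suc n. (z * coeff q k) *\<^sub>C (A ^^ k) v)"
    unfolding sum_subtractf by (subst sum.atMost_Suc_shift) simp
  also have "(\<Sum>k\<le>Suc n. (z * coeff q k) *\<^sub>C (A ^^ k) v) = z *\<^sub>C (\<Sum>k\<le>Suc n. coeff q k *\<^sub>C (A ^^ k) v)"
    by (simp only: complex_vector.scale_sum_right scaleC_scaleC)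
  also have "(\<Sum>k\<le>Suc n. coeff q k *\<^sub>C (A ^^ k) v) = poly_apply q A v"
    by (rule poly_apply_altdef[symmetric]) (simp add: n_def)
  also have "(\<Sum>k\<le>n. coeff q k *\<^sub>C A ((A ^^ k) v)) = A (poly_apply q A v)"
    unfolding poly_apply_def n_def by (simp add: clinear_sum[OF assms] clinear_scaleC[OF assms])
  finally show ?thesis .
qed

text \<open>Among the nonzero polynomials \<open>q\<close> with \<open>q(A) v = 0\<close> take one of least degree. By the fundamental
  theorem of algebra it splits as \<open>(X - z) s\<close>; minimality forces \<open>s(A) v \<noteq> 0\<close>, and \<open>A - z\<close> kills
  this vector. That the eigenvector has the form \<open>s(A) v\<close> keeps it inside every invariant subspace
  that contains \<open>v\<close>.\<close>

lemma eigenvector_exists: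
  fixes A :: "'h::fd_complex_hilbert \<Rightarrow> 'h"
  assumes "clinear A" "v \<noteq> 0"
  obtains q z where "poly_apply q A v \<noteq> 0" "A (poly_apply q A v) = z *\<^sub>C poly_apply q A v"
proof -
  define P where "P q \<longleftrightarrow> q \<noteq> 0 \<and> poly_apply q A v = 0" for q
  obtain n c i where c: "i \<le> n" "c i \<noteq> 0" "(\<Sum>k\<le>n. c k *\<^sub>C (A ^^ k) v) = 0"
    by (rule krylov_dependent)
  define r where "r = (\<Sum>k\<le>n. monom (c k) k)"
  have coeff: "coeff r k = (if k \<le> n then c k else 0)" for k
    by (simp add: r_def coeff_sum)
  then have "degree r \<le> n" by (intro degree_le) auto
  then have "poly_apply r A v = 0"
    using c(3) by (simp add: poly_apply_altdef coeff)
  moreover have "r \<noteq> 0" using coeff[of i] c(1,2) by auto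
  ultimately have "P r" by (simp add: P_def)
  then obtain q where q: "P q" and min: "\<And>q'. P q' \<Longrightarrow> degree q \<le> degree q'"
    using ex_has_least_nat[of P r degree] by blast
  have "degree q \<noteq> 0"
  proof
    assume d: "degree q = 0"
    then have "coeff q 0 *\<^sub>C v = 0" using q by (simp add: P_def poly_apply_def)
    moreover have "coeff q 0 \<noteq> 0" using q d by (metis P_def leading_coeff_0_iff)
    ultimately show False using assms(2) by simp
  qed
  then have "\<not> constant (poly q)" by (simp add: constant_degree)
  then obtain z where "poly q z = 0" using fundamental_theorem_of_algebra by blast
  then obtain s where s: "q = [:- z, 1:] * s" unfolding poly_eq_0_iff_dvd by (elim dvdE)
  have "s \<noteq> 0" using q s by (auto simp: P_def)
  then have "degree q = Suc (degree s)" unfolding s by (subst degree_mult_eq) auto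
  then have "\<not> P s" using min[of s] by auto
  then have "poly_apply s A v \<noteq> 0" using \<open>s \<noteq> 0\<close> by (simp add: P_def)
  moreover have "A (poly_apply s A v) = z *\<^sub>C poly_apply s A v"
    using q poly_apply_linear_factor[OF assms(1), of z s v] by (simp add: P_def s)
  ultimately show ?thesis using that by blast
qed

lemma exists_nonzero_orthogonal:
  fixes E :: "'h::fd_complex_hilbert set"
  assumes "orthonormal E" "cspan E \<noteq> UNIV"
  obtains x where "x \<noteq> 0" "\<And>e. e \<in> E \<Longrightarrow> cinner x e = 0"
proof -
  obtain y where y: "y \<notin> cspan E" using assms by blast
  define w where "w = (\<Sum>e\<in>E. cinner y e *\<^sub>C e)"
  have "w \<in> cspan E"
    unfolding w_def by (intro complex_vector.span_sum complex_vector.span_scale complex_vector.span_base)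
  then have "y - w \<noteq> 0" using y by auto
  moreover have "cinner (y - w) e = 0" if "e \<in> E" for e
    using cinner_orthonormal_combination[OF assms(1) orthonormal_finite[OF assms(1)] subset_refl that]
    by (simp add: cinner_diff_left w_def)
  ultimately show ?thesis using that by blast
qed

text \<open>An orthonormal set of eigenvectors of maximal cardinality must span the space: its orthogonal
  complement is invariant under the self-adjoint operator, so that it would otherwise contain one
  more eigenvector.\<close>

lemma selfadjoint_eigenbasis:
  fixes A :: "'h::fd_complex_hilbert \<Rightarrow> 'h"
  assumes lin: "clinear A" and sa: "\<And>x y. cinner (A x) y = cinner x (A y)"
  obtains E where "orthonormal_basis E" "\<And>e. e \<in> E \<Longrightarrow> \<exists>a. A e = a *\<^sub>C e"
proof -
  define P where "P E \<longleftrightarrow> orthonormal E \<and> (\<forall>e\<in>E. \<exists>a. A e = a *\<^sub>C e)" for E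
  obtain B :: "'h set" where B: "finite B" "cspan B = UNIV"
    by (rule finite_spanning_set)
  have "P {}" by (simp add: P_def orthonormal_def)
  moreover have "\<forall>E. P E \<longrightarrow> card E < Suc (card B)"
    using orthonormal_finite_card[OF _ B] by (auto simp: P_def less_Suc_eq_le)
  ultimately obtain E where E: "P E" and max: "\<And>F. P F \<Longrightarrow> card F \<le> card E"
    using ex_has_greatest_nat[of P "{}" card "Suc (card B)"] by auto
  have fin: "finite E" using E orthonormal_finite by (auto simp: P_def)
  have "cspan E = UNIV"
  proof (rule ccontr)
    assume "cspan E \<noteq> UNIV"
    then obtain v where v: "v \<noteq> 0" "\<And>e. e \<in> E \<Longrightarrow> cinner v e = 0"
      using exists_nonzero_orthogonal[of E] E by (auto simp: P_def)
    have orth: "cinner ((A ^^ k) v) e = 0" if e: "e \<in> E" for k e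
    proof (induction k)
      case (Suc k)
      obtain a where "A e = a *\<^sub>C e" using E e by (auto simp: P_def)
      then show ?case using Suc sa[of "(A ^^ k) v" e] by (simp add: cinner_scaleC_right)
    qed (use v e in auto)
    obtain q z where w: "poly_apply q A v \<noteq> 0" "A (poly_apply q A v) = z *\<^sub>C poly_apply q A v"
      using eigenvector_exists[OF lin v(1)] .
    define w where "w = poly_apply q A v"
    define u where "u = complex_of_real (1 / cnorm w) *\<^sub>C w"
    have we: "cinner w e = 0" if "e \<in> E" for e
      using orth[OF that] by (simp add: w_def poly_apply_def cinner_sum_left cinner_scaleC_left)
    have ue: "cinner u e = 0" "cinner e u = 0" if "e \<in> E" for e
      using we[OF that] cinner_commute[of e w]
      by (simp_all add: u_def cinner_scaleC_left cinner_scaleC_right)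
    have "cnorm u = 1" using w(1) by (simp add: u_def cnorm_scaleC w_def norm_divide)
    then have uu: "cinner u u = 1" by (simp add: cinner_self)
    have "u \<notin> E" using ue uu by auto
    have "A u = z *\<^sub>C u"
      using w(2) by (simp add: u_def w_def clinear_scaleC[OF lin] scaleC_scaleC mult.commute)
    then have "P (insert u E)" using E ue uu \<open>u \<notin> E\<close> by (auto simp: P_def orthonormal_def)
    then show False using max[of "insert u E"] fin \<open>u \<notin> E\<close> by simp
  qed
  then show ?thesis using that[of E] E by (auto simp: P_def orthonormal_basis_iff)
qed

lemma orthonormal_basis_exists: "\<exists>E :: 'h::fd_complex_hilbert set. orthonormal_basis E"
  by (rule selfadjoint_eigenbasis[of "\<lambda>x::'h. x"]) (auto intro: clinearI)

section \<open>Adjoints, singular bases and functional calculus\<close>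

text \<open>Expanding \<open>T x\<close> over an orthonormal basis \<open>E\<close> shows that \<open>y \<mapsto> \<Sum>e\<in>E. \<langle>y, T e\<rangle> e\<close> is an
  adjoint; the inner product separates points, so the description defining \<^term>\<open>cadjoint\<close> denotes it.\<close>

lemma cinner_cadjoint:
  assumes "clinear T"
  shows "cinner (T x) y = cinner x (cadjoint T y)"
proof -
  obtain E :: "'a set" where E: "orthonormal_basis E" using orthonormal_basis_exists by blast
  define A where "A y = (\<Sum>e\<in>E. cinner y (T e) *\<^sub>C e)" for y
  have A: "cinner (T x) y = cinner x (A y)" for x y
    by (subst clinear_basis_expansion[OF E assms])
      (simp add: A_def cinner_sum_left cinner_sum_right cinner_scaleC_left cinner_scaleC_right
        mult.commute flip: cinner_commute)
  have "A' = A" if "\<forall>x y. cinner (T x) y = cinner x (A' y)" for A'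
    by (rule ext, rule cinner_ext_right) (metis that A)
  then have "cadjoint T = A" unfolding cadjoint_def using A by (intro the_equality) auto
  then show ?thesis using A by simp
qed

lemma cinner_cadjoint': "clinear T \<Longrightarrow> cinner (cadjoint T y) x = cinner y (T x)"
  by (metis cinner_cadjoint cinner_commute)

lemma clinear_cadjoint:
  assumes "clinear T"
  shows "clinear (cadjoint T)"
  by (rule clinearI; rule cinner_ext)
    (simp_all add: cinner_cadjoint'[OF assms] cinner_add_left cinner_scaleC_left)

text \<open>A basis of right singular vectors, the eigenvectors of \<open>T\<^sup>*T\<close>, characterised without the adjoint.
  The singular value belonging to \<open>e\<close> is \<open>cnorm (T e)\<close>.\<close>

definition singular_basis :: "('h::fd_complex_hilbert \<Rightarrow> 'h) \<Rightarrow> 'h set \<Rightarrow> bool"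
  where "singular_basis T E \<longleftrightarrow> orthonormal_basis E \<and>
    (\<forall>e\<in>E. \<forall>e'\<in>E. e \<noteq> e' \<longrightarrow> cinner (T e) (T e') = 0)"

lemma singular_basis_exists:
  assumes "clinear T"
  obtains E where "singular_basis T E"
proof -
  have lin: "clinear (cadjoint T \<circ> T)" using assms by (intro clinear_comp clinear_cadjoint)
  have sa: "cinner ((cadjoint T \<circ> T) x) y = cinner x ((cadjoint T \<circ> T) y)" for x y
    by (simp add: cinner_cadjoint'[OF assms] flip: cinner_cadjoint[OF assms])
  obtain E where E: "orthonormal_basis E" "\<And>e. e \<in> E \<Longrightarrow> \<exists>a. (cadjoint T \<circ> T) e = a *\<^sub>C e"
    using selfadjoint_eigenbasis[OF lin sa] by blast
  have "cinner (T e) (T e') = 0" if e: "e \<in> E" "e' \<in> E" "e \<noteq> e'" for e e'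
  proof -
    obtain a where "cadjoint T (T e) = a *\<^sub>C e" using E(2)[OF e(1)] by auto
    then have "cinner (T e) (T e') = a * cinner e e'"
      by (simp add: cinner_scaleC_left flip: cinner_cadjoint'[OF assms])
    then show ?thesis using E(1) e by (simp add: orthonormal_basis_def)
  qed
  then have "singular_basis T E" using E(1) by (simp add: singular_basis_def)
  then show ?thesis by (rule that)
qed

text \<open>If \<open>A v = b v\<close>, then each coefficient of \<open>v\<close> in the eigenbasis vanishes unless its eigenvalue is
  \<open>b\<close>; so the operator that is diagonal in \<open>E\<close> with entries \<open>a e powr r\<close> acts correctly on every
  eigenvector. It is the only one, because \<open>E\<close> spans.\<close>

lemma op_powr_eigenbasis:
  fixes A :: "'h::fd_complex_hilbert \<Rightarrow> 'h"
  assumes E: "orthonormal_basis E" and lin: "clinear A"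
    and eig: "\<And>e. e \<in> E \<Longrightarrow> A e = complex_of_real (a e) *\<^sub>C e"
  shows "op_powr A r = (\<lambda>x. \<Sum>e\<in>E. (cinner x e * complex_of_real (a e powr r)) *\<^sub>C e)"
proof -
  define B where "B x = (\<Sum>e\<in>E. (cinner x e * complex_of_real (a e powr r)) *\<^sub>C e)" for x
  have linB: "clinear B"
    by (intro clinearI) (simp_all add: B_def cinner_add_left cinner_scaleC_left distrib_right scaleC_add_left
        sum.distrib complex_vector.scale_sum_right scaleC_scaleC mult.assoc)
  have B: "B v = complex_of_real (b powr r) *\<^sub>C v" if v: "A v = complex_of_real b *\<^sub>C v" for b v
  proof -
    have "cinner v e * complex_of_real (a e powr r) = complex_of_real (b powr r) * cinner v e"
      if e: "e \<in> E" for e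
    proof -
      have "cinner (A v) e = (\<Sum>x\<in>E. (cinner v x * a x) * cinner x e)"
        by (subst clinear_basis_expansion[OF E lin])
          (simp add: cinner_sum_left cinner_scaleC_left eig scaleC_scaleC)
      also have "\<dots> = (\<Sum>x\<in>E. if x = e then cinner v x * a x else 0)"
        using E e by (intro sum.cong) (auto simp: orthonormal_basis_def)
      also have "\<dots> = cinner v e * a e" using e orthonormal_basis_finite[OF E] by simp
      finally have "cinner v e * (complex_of_real (a e) - complex_of_real b) = 0"
        using v by (auto simp: cinner_scaleC_left algebra_simps)
      then have "cinner v e = 0 \<or> a e = b"
        by (metis mult_eq_0_iff right_minus_eq of_real_eq_iff)
      then show ?thesis by auto
    qed
    then have "B v = (\<Sum>e\<in>E. complex_of_real (b powr r) *\<^sub>C (cinner v e *\<^sub>C e))"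
      unfolding B_def by (intro sum.cong) (auto simp: scaleC_scaleC)
    also have "\<dots> = complex_of_real (b powr r) *\<^sub>C v"
      by (simp only: complex_vector.scale_sum_right[symmetric] orthonormal_basis_expansion[OF E, symmetric])
    finally show ?thesis .
  qed
  have unique: "B' = B" if "clinear B'"
    "\<forall>(b::real) v. A v = complex_of_real b *\<^sub>C v \<longrightarrow> B' v = complex_of_real (b powr r) *\<^sub>C v" for B'
  proof
    fix x
    show "B' x = B x"
      using E that(1) linB by (rule clinear_eq_on_basis) (metis that(2) B eig)
  qed
  have "op_powr A r = B"
    unfolding op_powr_def
  proof (rule the_equality)
    show "clinear B \<and> (\<forall>(b::real) v. A v = complex_of_real b *\<^sub>C v \<longrightarrow> B v = complex_of_real (b powr r) *\<^sub>C v)"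
      using linB B by blast
  qed (use unique in blast)
  then show ?thesis by (simp add: B_def fun_eq_iff)
qed

lemma
  fixes A :: "'h::fd_complex_hilbert \<Rightarrow> 'h"
  assumes E: "orthonormal_basis E" and lin: "clinear A"
    and eig: "\<And>e. e \<in> E \<Longrightarrow> A e = complex_of_real (a e) *\<^sub>C e"
  shows clinear_op_powr: "clinear (op_powr A r)"
    and cinner_op_powr: "e \<in> E \<Longrightarrow> cinner (op_powr A r x) e = cinner x e * complex_of_real (a e powr r)"
    and op_powr_eigenvector: "e \<in> E \<Longrightarrow> op_powr A r e = complex_of_real (a e powr r) *\<^sub>C e"
proof -
  have eq: "op_powr A r = (\<lambda>x. \<Sum>e\<in>E. (cinner x e * complex_of_real (a e powr r)) *\<^sub>C e)"
    using E lin eig by (rule op_powr_eigenbasis)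
  show "clinear (op_powr A r)"
    unfolding eq
    by (intro clinearI) (simp_all add: cinner_add_left cinner_scaleC_left distrib_right scaleC_add_left
        sum.distrib complex_vector.scale_sum_right scaleC_scaleC mult.assoc)
  assume e: "e \<in> E"
  show "cinner (op_powr A r x) e = cinner x e * complex_of_real (a e powr r)" for x
    using E e unfolding eq 
    by (subst cinner_orthonormal_combination[of E]) (auto simp: orthonormal_basis_iff orthonormal_finite)
  have "op_powr A r e = (\<Sum>x\<in>E. if x = e then complex_of_real (a e powr r) *\<^sub>C e else 0)"
    using E e unfolding eq
    by (intro sum.cong) (auto simp: orthonormal_basis_def)
  then show "op_powr A r e = complex_of_real (a e powr r) *\<^sub>C e"
    using e orthonormal_basis_finite[OF E] by simp
qed

section \<open>Schatten norms in a singular basis\<close>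

lemma singular_basis_orthonormal: "singular_basis T E \<Longrightarrow> orthonormal_basis E"
  by (simp add: singular_basis_def)

lemma singular_basis_finite: "singular_basis T E \<Longrightarrow> finite E"
  by (simp add: singular_basis_def orthonormal_basis_finite)

lemma singular_basis_orthogonal:
  "singular_basis T E \<Longrightarrow> e \<in> E \<Longrightarrow> e' \<in> E \<Longrightarrow> e \<noteq> e' \<Longrightarrow> cinner (T e) (T e') = 0"
  by (simp add: singular_basis_def)

lemma orthonormal_basis_cnorm:
  assumes "orthonormal_basis E" "e \<in> E"
  shows "cnorm e = 1"
  using assms by (simp add: orthonormal_basis_def cnorm_def)

lemma op_abs_singular:
  assumes "clinear T" "singular_basis T E"
  shows clinear_op_abs: "clinear (op_abs T)"
    and op_abs_singular_vector: "e \<in> E \<Longrightarrow> op_abs T e = complex_of_real (cnorm (T e)) *\<^sub>C e"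
proof -
  note E = singular_basis_orthonormal[OF assms(2)]
  have lin: "clinear (cadjoint T \<circ> T)" using assms by (intro clinear_comp clinear_cadjoint)
  have eig: "(cadjoint T \<circ> T) e = complex_of_real ((cnorm (T e))\<^sup>2) *\<^sub>C e" if e: "e \<in> E" for e
  proof -
    have "(cadjoint T \<circ> T) e = (\<Sum>x\<in>E. cinner (T e) (T x) *\<^sub>C x)"
      by (subst orthonormal_basis_expansion[OF E, of "(cadjoint T \<circ> T) e"])
        (simp add: cinner_cadjoint'[OF assms(1)])
    also have "\<dots> = (\<Sum>x\<in>E. if x = e then cinner (T e) (T e) *\<^sub>C e else 0)"
      using singular_basis_orthogonal[OF assms(2)] e by (intro sum.cong) auto
    also have "\<dots> = complex_of_real ((cnorm (T e))\<^sup>2) *\<^sub>C e"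
      using e orthonormal_basis_finite[OF E] by (simp add: cinner_self)
    finally show ?thesis .
  qed
  show "clinear (op_abs T)"
    unfolding op_abs_def using E lin eig by (rule clinear_op_powr)
  assume e: "e \<in> E"
  have "op_abs T e = complex_of_real (((cnorm (T e))\<^sup>2) powr (1/2)) *\<^sub>C e"
    unfolding op_abs_def using E lin eig e by (rule op_powr_eigenvector)
  then show "op_abs T e = complex_of_real (cnorm (T e)) *\<^sub>C e"
    by (simp add: powr_half_sqrt)
qed

lemma
  assumes "clinear T" "singular_basis T E"
  shows clinear_op_powr_op_abs: "clinear (op_powr (op_abs T) r)"
    and cinner_op_powr_op_abs:
      "e \<in> E \<Longrightarrow> cinner (op_powr (op_abs T) r x) e = cinner x e * complex_of_real (cnorm (T e) powr r)"
proof -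
  note E = singular_basis_orthonormal[OF assms(2)] and abs = op_abs_singular[OF assms]
  show "clinear (op_powr (op_abs T) r)" using E abs by (rule clinear_op_powr)
  assume "e \<in> E"
  with E abs show "cinner (op_powr (op_abs T) r x) e = cinner x e * complex_of_real (cnorm (T e) powr r)"
    by (rule cinner_op_powr)
qed

lemma ctrace_op_powr_op_abs:
  assumes "clinear T" "singular_basis T E"
  shows "ctrace (op_powr (op_abs T) p) = complex_of_real (\<Sum>e\<in>E. cnorm (T e) powr p)"
proof -
  note E = singular_basis_orthonormal[OF assms(2)]
  have "ctrace (op_powr (op_abs T) p) = (\<Sum>e\<in>E. complex_of_real (cnorm (T e) powr p))"
    unfolding ctrace_basis[OF E clinear_op_powr_op_abs[OF assms]]
    using orthonormal_basis_cnorm[OF E]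
    by (intro sum.cong) (simp_all add: cinner_op_powr_op_abs[OF assms] cinner_self)
  then show ?thesis by simp
qed

lemma schatten_norm_nonneg: "0 \<le> schatten_norm p T"
  by (simp add: schatten_norm_def)

lemma schatten_norm_singular:
  assumes "clinear T" "singular_basis T E"
  shows "schatten_norm p T = (\<Sum>e\<in>E. cnorm (T e) powr p) powr (1/p)"
  by (simp add: schatten_norm_def ctrace_op_powr_op_abs[OF assms])

lemma schatten_norm_powr:
  assumes "clinear T" "singular_basis T E" "1 \<le> p"
  shows "schatten_norm p T powr p = (\<Sum>e\<in>E. cnorm (T e) powr p)"
proof -
  have "0 \<le> (\<Sum>e\<in>E. cnorm (T e) powr p)" by (intro sum_nonneg) simp
  then show ?thesis using assms(3) by (simp add: schatten_norm_singular[OF assms(1,2)] powr_powr)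
qed

lemma schatten_norm_eq_0:
  assumes "clinear T" "1 \<le> p"
  shows "schatten_norm p T = 0 \<longleftrightarrow> T = (\<lambda>x. 0)"
proof -
  obtain E where E: "singular_basis T E" using singular_basis_exists[OF assms(1)] .
  have "schatten_norm p T = 0 \<longleftrightarrow> (\<Sum>e\<in>E. cnorm (T e) powr p) = 0"
    by (simp add: schatten_norm_singular[OF assms(1) E])
  also have "\<dots> \<longleftrightarrow> (\<forall>e\<in>E. T e = 0)"
    by (subst sum_nonneg_eq_0_iff) (auto simp: singular_basis_finite[OF E])
  also have "\<dots> \<longleftrightarrow> T = (\<lambda>x. 0)"
  proof
    assume "\<forall>e\<in>E. T e = 0"
    then show "T = (\<lambda>x. 0)"
      by (intro ext, subst clinear_basis_expansion[OF singular_basis_orthonormal[OF E] assms(1)]) simp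
  qed simp
  finally show ?thesis .
qed

lemma singular_basis_scaleC: "singular_basis T E \<Longrightarrow> singular_basis (\<lambda>x. c *\<^sub>C T x) E"
  by (simp add: singular_basis_def cinner_scaleC_left cinner_scaleC_right)

lemma schatten_norm_scaleC:
  assumes "clinear T" "1 \<le> p"
  shows "schatten_norm p (\<lambda>x. c *\<^sub>C T x) = cmod c * schatten_norm p T"
proof -
  obtain E where E: "singular_basis T E" using singular_basis_exists[OF assms(1)] .
  have "(\<Sum>e\<in>E. cnorm (c *\<^sub>C T e) powr p) = cmod c powr p * (\<Sum>e\<in>E. cnorm (T e) powr p)"
    by (simp add: cnorm_scaleC powr_mult sum_distrib_left)
  then show ?thesis
    using assms
    by (simp add: schatten_norm_singular[OF clinear_scaled[OF assms(1)] singular_basis_scaleC[OF E]]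
        schatten_norm_singular[OF assms(1) E] powr_mult sum_nonneg powr_powr)
qed

section \<open>The duality pairing\<close>

text \<open>This is \<open>tr (|T|\<^bsup>p-1\<^esup> U\<^sup>*S)\<close>, where \<open>U\<close> is the polar factor of \<open>T\<close>, computed in the singular basis
  \<open>E\<close>. As \<open>U e = T e / cnorm (T e)\<close>, the exponent drops from \<open>p - 1\<close> to \<open>p - 2\<close>; vectors in the
  kernel of \<open>T\<close> contribute nothing, since the inner product with \<open>T e\<close> vanishes.\<close>

definition duality_pairing ::
    "real \<Rightarrow> ('h::fd_complex_hilbert \<Rightarrow> 'h) \<Rightarrow> 'h set \<Rightarrow> ('h \<Rightarrow> 'h) \<Rightarrow> complex"
  where "duality_pairing p T E S =
    (\<Sum>e\<in>E. complex_of_real (cnorm (T e) powr (p - 2)) * cinner (S e) (T e))"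

lemma powr_minus_two_mult:
  fixes t :: real
  assumes "0 \<le> t"
  shows "t powr (p - 2) * t = t powr (p - 1)"
proof (cases "t = 0")
  case False
  have "t powr (p - 2) * t powr 1 = t powr (p - 1)" by (subst powr_add[symmetric]) simp
  then show ?thesis using powr_one[OF assms] by metis
qed simp

lemma duality_pairing_add:
  "duality_pairing p T E (\<lambda>x. A x + c *\<^sub>C B x) = duality_pairing p T E A + c * duality_pairing p T E B"
  by (simp add: duality_pairing_def cinner_add_left cinner_scaleC_left distrib_left sum.distrib
      sum_distrib_left mult.left_commute)

lemma duality_pairing_scaleC_right:
  "duality_pairing p T E (\<lambda>x. c *\<^sub>C B x) = c * duality_pairing p T E B"
  by (simp add: duality_pairing_def cinner_scaleC_left sum_distrib_left mult.left_commute)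

lemma duality_pairing_scale_left:
  assumes "0 < a"
  shows "duality_pairing p (\<lambda>x. complex_of_real a *\<^sub>C T x) E S
    = complex_of_real (a powr (p - 1)) * duality_pairing p T E S"
proof -
  have "complex_of_real ((a * cnorm (T e)) powr (p - 2)) * (complex_of_real a * cinner (S e) (T e))
      = complex_of_real (a powr (p - 1)) * (complex_of_real (cnorm (T e) powr (p - 2)) * cinner (S e) (T e))"
    for e
    using assms by (simp add: powr_mult flip: powr_minus_two_mult)
  then show ?thesis
    unfolding duality_pairing_def sum_distrib_left using assms
    by (intro sum.cong refl) (simp add: cnorm_scaleC cinner_scaleC_right)
qed

lemma duality_pairing_self:
  assumes "clinear T" "singular_basis T E" "1 \<le> p"
  shows "duality_pairing p T E T = complex_of_real (schatten_norm p T powr p)"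
proof -
  have "cnorm (T e) powr (p - 2) * (cnorm (T e))\<^sup>2 = cnorm (T e) powr p" for e
    using powr_minus_two_mult[of "cnorm (T e)" p] powr_mult_base[of "cnorm (T e)" "p - 1"]
    by (simp add: power2_eq_square mult_ac)
  then have "complex_of_real (cnorm (T e) powr (p - 2)) * cinner (T e) (T e)
      = complex_of_real (cnorm (T e) powr p)" for e
    unfolding cinner_self by (metis of_real_mult)
  then show ?thesis
    by (simp add: duality_pairing_def schatten_norm_powr[OF assms])
qed

text \<open>Vectors of \<open>E\<close> in the kernel of \<open>T\<close> contribute nothing to the trace, since \<open>0 powr (p - 1) = 0\<close>;
  on the others \<open>U e\<close> is \<open>T e\<close> divided by the singular value.\<close>

lemma ctrace_polar_dual:
  assumes T: "clinear T" "singular_basis T E" and S: "clinear S" and U: "polar_decomposition T U"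
    and p: "1 < p \<or> (p = 1 \<and> bij T)"
  shows "ctrace (op_powr (op_abs T) (p - 1) \<circ> cadjoint U \<circ> S) = duality_pairing p T E S"
proof -
  note E = singular_basis_orthonormal[OF T(2)]
  have linU: "clinear U" using U by (simp add: polar_decomposition_def partial_isometry_def)
  have lin: "clinear (op_powr (op_abs T) (p - 1) \<circ> cadjoint U \<circ> S)"
    using T S linU by (intro clinear_comp clinear_op_powr_op_abs clinear_cadjoint)
  have "cinner ((op_powr (op_abs T) (p - 1) \<circ> cadjoint U \<circ> S) e) e
      = complex_of_real (cnorm (T e) powr (p - 2)) * cinner (S e) (T e)" if e: "e \<in> E" for e
  proof -
    have "T e = U (op_abs T e)"
      using U unfolding polar_decomposition_def by (metis comp_apply)
    then have Te: "T e = complex_of_real (cnorm (T e)) *\<^sub>C U e"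
      using op_abs_singular_vector[OF T e] by (simp add: clinear_scaleC[OF linU])
    have "complex_of_real (cnorm (T e) powr (p - 2)) * cinner (S e) (T e)
        = complex_of_real (cnorm (T e) powr (p - 2) * cnorm (T e)) * cinner (S e) (U e)"
      by (subst (2) Te) (simp add: cinner_scaleC_right)
    also have "\<dots> = cinner ((op_powr (op_abs T) (p - 1) \<circ> cadjoint U \<circ> S) e) e"
      by (simp add: cinner_op_powr_op_abs[OF T e] cinner_cadjoint'[OF linU] powr_minus_two_mult
          del: of_real_mult)
    finally show ?thesis by simp
  qed
  then show ?thesis by (simp add: ctrace_basis[OF E lin] duality_pairing_def del: comp_apply)
qed

section \<open>Young's inequality for numbers\<close>

text \<open>With \<open>A = t\<^sup>p\<close>, \<open>B = s\<^sup>p\<close> and their weighted mean \<open>m\<close>, this is the weighted inequality of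
  arithmetic and geometric means. It follows from \<open>ln x \<le> x - 1\<close> at \<open>A/m\<close> and \<open>B/m\<close>, because the
  right-hand sides average to zero; equality in the mean forces equality in both, hence
  \<open>A = m = B\<close>.\<close>

lemma young_powr_pos:
  fixes t s p :: real
  assumes "0 < t" "0 < s" "1 \<le> p"
  defines "m \<equiv> (p - 1) / p * t powr p + s powr p / p"
  shows "t powr (p - 1) * s \<le> m"
    and "1 < p \<Longrightarrow> t powr (p - 1) * s = m \<Longrightarrow> t = s"
proof -
  define a b where "a = t powr p / m" and "b = s powr p / m"
  have m: "0 < m" using assms by (simp add: m_def add_nonneg_pos)
  have ab: "0 < a" "0 < b" using assms m by (simp_all add: a_def b_def)
  \<comment> \<open>\<open>m\<close> is the weighted mean of \<open>t\<^sup>p\<close> and \<open>s\<^sup>p\<close>, so the rescaled numbers have mean one\<close>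
  have mean: "(p - 1) / p * a + b / p = 1"
  proof -
    have "(p - 1) / p * a + b / p = ((p - 1) / p * t powr p + s powr p / p) / m"
      unfolding a_def b_def by (simp add: add_divide_distrib mult.commute)
    then show ?thesis using m unfolding m_def[symmetric] by simp
  qed
  have ln_eq: "ln (t powr (p - 1) * s) = ln m + (p - 1) / p * ln a + ln b / p"
  proof -
    have ln_ab: "ln a = p * ln t - ln m" "ln b = p * ln s - ln m"
      using assms m by (simp_all add: a_def b_def ln_div ln_powr)
    have "ln m + (p - 1) / p * ln a + ln b / p = (p - 1) * ln t + ln s"
      unfolding ln_ab using assms(3) by (simp add: field_simps)
    then show ?thesis using assms by (simp add: ln_mult ln_powr)
  qed
  have la: "(p - 1) / p * ln a \<le> (p - 1) / p * (a - 1)" and lb: "ln b / p \<le> (b - 1) / p"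
    using ab assms(3) ln_le_minus_one by (auto intro!: mult_left_mono divide_right_mono)
  \<comment> \<open>the right-hand sides of \<open>la\<close> and \<open>lb\<close> cancel\<close>
  have sum0: "(p - 1) / p * (a - 1) + (b - 1) / p = 0"
    using mean assms(3) by (simp add: field_simps)
  have pos: "0 < t powr (p - 1) * s" using assms by simp
  have "ln (t powr (p - 1) * s) \<le> ln m" using ln_eq la lb sum0 by linarith
  then show "t powr (p - 1) * s \<le> m" using pos m by simp
  assume p: "1 < p" and eq: "t powr (p - 1) * s = m"
  have "ln (t powr (p - 1) * s) = ln m" by (simp only: eq)
  then have "(p - 1) / p * ln a = (p - 1) / p * (a - 1)" "ln b / p = (b - 1) / p"
    using ln_eq la lb sum0 by linarith+
  then have "ln a = a - 1" "ln b = b - 1" using p by simp_all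
  then have "a = 1" "b = 1" using ab ln_eq_minus_one by blast+
  then have "t powr p = s powr p" using m by (simp add: a_def b_def)
  then show "t = s"
    using powr_less_mono2[of p t s] powr_less_mono2[of p s t] assms p by linarith
qed

lemma young_powr:
  fixes t s p :: real
  assumes "0 \<le> t" "0 \<le> s" "1 \<le> p"
  shows "t powr (p - 1) * s \<le> (p - 1) / p * t powr p + s powr p / p"
  using young_powr_pos(1)[of t s p] assms by (cases "t = 0 \<or> s = 0") auto

lemma young_powr_eq:
  fixes t s p :: real
  assumes "0 \<le> t" "0 \<le> s" "1 < p"
    and eq: "t powr (p - 1) * s = (p - 1) / p * t powr p + s powr p / p"
  shows "t = s"
proof (cases "t = 0 \<or> s = 0")
  case True
  then show ?thesis using eq assms by auto
next
  case False
  then show ?thesis using young_powr_pos(2)[of t s p] assms by simp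
qed

section \<open>Young's inequality for traces\<close>

lemma cnorm_sum_orthogonal:
  assumes "\<And>i j. i \<in> I \<Longrightarrow> j \<in> I \<Longrightarrow> i \<noteq> j \<Longrightarrow> cinner (f i) (f j) = 0"
  shows "(cnorm (\<Sum>i\<in>I. c i *\<^sub>C f i))\<^sup>2 = (\<Sum>i\<in>I. (cmod (c i))\<^sup>2 * (cnorm (f i))\<^sup>2)"
proof (cases "finite I")
  case True
  have "cinner (\<Sum>i\<in>I. c i *\<^sub>C f i) (\<Sum>i\<in>I. c i *\<^sub>C f i)
      = (\<Sum>i\<in>I. c i * cinner (f i) (\<Sum>j\<in>I. c j *\<^sub>C f j))"
    by (simp only: cinner_sum_left cinner_scaleC_left)
  also have "\<dots> = (\<Sum>i\<in>I. \<Sum>j\<in>I. c i * (cnj (c j) * cinner (f i) (f j)))"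
    by (simp only: cinner_sum_right cinner_scaleC_right sum_distrib_left)
  also have "\<dots> = (\<Sum>i\<in>I. \<Sum>j\<in>I. if j = i then c i * (cnj (c i) * cinner (f i) (f i)) else 0)"
    using assms by (intro sum.cong refl) auto
  also have "\<dots> = (\<Sum>i\<in>I. complex_of_real ((cmod (c i))\<^sup>2 * (cnorm (f i))\<^sup>2))"
    using True by (simp add: cinner_self complex_norm_square mult.assoc del: of_real_power)
  finally show ?thesis
    unfolding cinner_self of_real_sum[symmetric] of_real_eq_iff .
qed simp

text \<open>Expand \<open>0 \<le> \<parallel>x - w\<parallel>\<^sup>2\<close> for \<open>w = \<Sum>i\<in>I. \<langle>x, f i\<rangle> f i\<close>. Vectors shorter than one are admitted
  because the left singular vectors defined below may be zero.\<close>

lemma bessel_inequality: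
  assumes orth: "\<And>i j. i \<in> I \<Longrightarrow> j \<in> I \<Longrightarrow> i \<noteq> j \<Longrightarrow> cinner (f i) (f j) = 0"
    and le1: "\<And>i. i \<in> I \<Longrightarrow> cnorm (f i) \<le> 1"
  shows "(\<Sum>i\<in>I. (cmod (cinner x (f i)))\<^sup>2) \<le> (cnorm x)\<^sup>2"
proof -
  define w where "w = (\<Sum>i\<in>I. cinner x (f i) *\<^sub>C f i)"
  define b where "b = (\<Sum>i\<in>I. (cmod (cinner x (f i)))\<^sup>2)"
  have "(cnorm w)\<^sup>2 = (\<Sum>i\<in>I. (cmod (cinner x (f i)))\<^sup>2 * (cnorm (f i))\<^sup>2)"
    unfolding w_def by (intro cnorm_sum_orthogonal orth)
  also have "\<dots> \<le> b"
    unfolding b_def by (intro sum_mono mult_left_le) (auto simp: power_le_one le1)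
  finally have "(cnorm w)\<^sup>2 \<le> b" .
  moreover have "Re (cinner x w) = b"
    unfolding w_def b_def
    by (simp add: cinner_sum_right cinner_scaleC_right cmod_power2 flip: power2_eq_square)
  moreover have "0 \<le> (cnorm (x - w))\<^sup>2" by simp
  ultimately show ?thesis unfolding cnorm_diff_square b_def by linarith
qed

text \<open>The left singular vector belonging to \<open>e\<close>; it is zero if \<open>T e = 0\<close>, as the partial isometry
  in the polar decomposition vanishes there.\<close>

definition polar_vec :: "('h::fd_complex_hilbert \<Rightarrow> 'h) \<Rightarrow> 'h \<Rightarrow> 'h"
  where "polar_vec T e = complex_of_real (1 / cnorm (T e)) *\<^sub>C T e"

lemma scale_polar_vec: "T e = complex_of_real (cnorm (T e)) *\<^sub>C polar_vec T e"
  by (simp add: polar_vec_def scaleC_scaleC scaleC_one complex_vector.scale_eq_0_iff)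

lemma cnorm_polar_vec: "cnorm (polar_vec T e) = (if T e = 0 then 0 else 1)"
  by (simp add: polar_vec_def cnorm_scaleC norm_divide)

lemma polar_vec_orthogonal:
  "singular_basis T E \<Longrightarrow> e \<in> E \<Longrightarrow> e' \<in> E \<Longrightarrow> e \<noteq> e' \<Longrightarrow> cinner (polar_vec T e) (polar_vec T e') = 0"
  by (simp add: polar_vec_def cinner_scaleC_left cinner_scaleC_right singular_basis_orthogonal)

lemma bessel_polar_vec:
  assumes "singular_basis T E"
  shows "(\<Sum>e\<in>E. (cmod (cinner x (polar_vec T e)))\<^sup>2) \<le> (cnorm x)\<^sup>2"
  using polar_vec_orthogonal[OF assms] by (intro bessel_inequality) (auto simp: cnorm_polar_vec)

lemma cmod_cinner_commute: "cmod (cinner x y) = cmod (cinner y x)"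
  by (metis cinner_commute complex_mod_cnj)

lemma mean_square_minus_Re:
  "((cmod a)\<^sup>2 + (cmod b)\<^sup>2) / 2 - Re (a * b) = (cmod (a - cnj b))\<^sup>2 / 2"
  by (simp add: cmod_power2) (simp add: power2_eq_square algebra_simps)

text \<open>Singular value decompositions of two operators on the same space, to be compared with each other.\<close>

locale singular_pair =
  fixes T S :: "'h::fd_complex_hilbert \<Rightarrow> 'h" and E G :: "'h set"
  assumes linT: "clinear T" and linS: "clinear S"
    and E: "singular_basis T E" and G: "singular_basis S G"
begin

definition weight :: "'h \<Rightarrow> 'h \<Rightarrow> real"
  where "weight e g =
    ((cmod (cinner e g))\<^sup>2 + (cmod (cinner (polar_vec S g) (polar_vec T e)))\<^sup>2) / 2"

definition overlap :: "'h \<Rightarrow> 'h \<Rightarrow> complex"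
  where "overlap e g = cinner e g * cinner (polar_vec S g) (polar_vec T e)"

text \<open>The amount that the pair \<open>(e, g)\<close> loses in Young's inequality: \<open>t\<^bsup>p-1\<^esup> s Re (overlap e g)\<close> is
  its contribution to the trace, and Young's inequality for the singular values \<open>t\<close> and \<open>s\<close>,
  weighted by \<open>weight e g \<ge> Re (overlap e g)\<close>, gives the upper bound.\<close>

definition slack :: "real \<Rightarrow> 'h \<Rightarrow> 'h \<Rightarrow> real"
  where "slack p e g =
    weight e g * ((p - 1) / p * cnorm (T e) powr p + cnorm (S g) powr p / p)
      - cnorm (T e) powr (p - 1) * cnorm (S g) * Re (overlap e g)"

lemmas basisE = singular_basis_orthonormal[OF E]
  and basisG = singular_basis_orthonormal[OF G]
  and finiteE = singular_basis_finite[OF E]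
  and finiteG = singular_basis_finite[OF G]

lemma weight_nonneg: "0 \<le> weight e g"
  by (simp add: weight_def)

lemma weight_minus_overlap:
  "weight e g - Re (overlap e g)
    = (cmod (cinner e g - cnj (cinner (polar_vec S g) (polar_vec T e))))\<^sup>2 / 2"
  unfolding weight_def overlap_def by (rule mean_square_minus_Re)

lemma overlap_le_weight: "Re (overlap e g) \<le> weight e g"
proof -
  have "0 \<le> weight e g - Re (overlap e g)" unfolding weight_minus_overlap by simp
  then show ?thesis by simp
qed

text \<open>Together with the column sums this says that the weights form a doubly substochastic matrix: the
  squared moduli \<open>|\<langle>e, g\<rangle>|\<^sup>2\<close> sum to one by Parseval, those of the left singular vectors to at
  most one by Bessel.\<close>

lemma weight_row_sum:
  assumes "e \<in> E"
  shows "(\<Sum>g\<in>G. weight e g) \<le> 1"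
proof -
  have "(\<Sum>g\<in>G. (cmod (cinner e g))\<^sup>2) = 1"
    by (simp add: parseval_cnorm[OF basisG] orthonormal_basis_cnorm[OF basisE assms])
  moreover have "(\<Sum>g\<in>G. (cmod (cinner (polar_vec S g) (polar_vec T e)))\<^sup>2) \<le> 1"
    using bessel_polar_vec[OF G, of "polar_vec T e"]
    by (auto simp: cmod_cinner_commute[of "polar_vec S _"] cnorm_polar_vec split: if_splits)
  ultimately show ?thesis
    by (simp add: weight_def sum.distrib flip: sum_divide_distrib)
qed

lemma weight_column_sum:
  assumes "g \<in> G"
  shows "(\<Sum>e\<in>E. weight e g) \<le> 1"
proof -
  have "(\<Sum>e\<in>E. (cmod (cinner e g))\<^sup>2) = 1"
    by (simp add: cmod_cinner_commute[of _ g] parseval_cnorm[OF basisE]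
        orthonormal_basis_cnorm[OF basisG assms])
  moreover have "(\<Sum>e\<in>E. (cmod (cinner (polar_vec S g) (polar_vec T e)))\<^sup>2) \<le> 1"
    using bessel_polar_vec[OF E, of "polar_vec S g"] by (auto simp: cnorm_polar_vec split: if_splits)
  ultimately show ?thesis
    by (simp add: weight_def sum.distrib flip: sum_divide_distrib)
qed

lemma cinner_matrix_entry:
  "cinner (S e) (T e) = (\<Sum>g\<in>G. complex_of_real (cnorm (T e) * cnorm (S g)) * overlap e g)"
proof -
  have "cinner (S e) (T e) = (\<Sum>g\<in>G. cinner e g * cinner (S g) (T e))"
    by (subst clinear_basis_expansion[OF basisG linS]) (simp add: cinner_sum_left cinner_scaleC_left)
  also have "\<dots> = (\<Sum>g\<in>G. complex_of_real (cnorm (T e) * cnorm (S g)) * overlap e g)"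
  proof (intro sum.cong refl)
    fix g
    show "cinner e g * cinner (S g) (T e) = complex_of_real (cnorm (T e) * cnorm (S g)) * overlap e g"
      unfolding overlap_def
      by (subst scale_polar_vec[of S g], subst scale_polar_vec[of T e])
        (simp add: cinner_scaleC_left cinner_scaleC_right)
  qed
  finally show ?thesis .
qed

lemma duality_pairing_overlap:
  "Re (duality_pairing p T E S)
    = (\<Sum>e\<in>E. \<Sum>g\<in>G. cnorm (T e) powr (p - 1) * cnorm (S g) * Re (overlap e g))"
proof -
  have "duality_pairing p T E S
      = (\<Sum>e\<in>E. \<Sum>g\<in>G. complex_of_real (cnorm (T e) powr (p - 2) * cnorm (T e) * cnorm (S g)) * overlap e g)"
    by (simp add: duality_pairing_def cinner_matrix_entry sum_distrib_left mult.assoc)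
  then show ?thesis by (simp add: powr_minus_two_mult)
qed

lemma slack_nonneg:
  assumes "1 \<le> p"
  shows "0 \<le> slack p e g"
proof -
  define y where "y = (p - 1) / p * cnorm (T e) powr p + cnorm (S g) powr p / p"
  have "cnorm (T e) powr (p - 1) * cnorm (S g) * Re (overlap e g)
      \<le> cnorm (T e) powr (p - 1) * cnorm (S g) * weight e g"
    by (intro mult_left_mono overlap_le_weight) simp
  also have "\<dots> \<le> y * weight e g"
    using young_powr[of "cnorm (T e)" "cnorm (S g)" p] assms weight_nonneg unfolding y_def
    by (intro mult_right_mono) auto
  finally show ?thesis by (simp add: slack_def y_def mult.commute)
qed

text \<open>The weighted Young bounds add up to at most the right-hand side because the weights are doubly
  substochastic: rows bound the part with the singular values of \<open>T\<close>, columns that of \<open>S\<close>.\<close>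

lemma sum_slack_le:
  assumes "1 \<le> p"
  shows "(\<Sum>e\<in>E. \<Sum>g\<in>G. slack p e g)
    \<le> (p - 1) / p * (\<Sum>e\<in>E. cnorm (T e) powr p) + (\<Sum>g\<in>G. cnorm (S g) powr p) / p
      - Re (duality_pairing p T E S)"
proof -
  have "(\<Sum>e\<in>E. \<Sum>g\<in>G. weight e g * ((p - 1) / p * cnorm (T e) powr p + cnorm (S g) powr p / p))
      = (\<Sum>e\<in>E. (\<Sum>g\<in>G. weight e g) * ((p - 1) / p * cnorm (T e) powr p))
        + (\<Sum>e\<in>E. \<Sum>g\<in>G. weight e g * (cnorm (S g) powr p / p))"
    by (simp only: distrib_left sum.distrib sum_distrib_right)
  also have "(\<Sum>e\<in>E. \<Sum>g\<in>G. weight e g * (cnorm (S g) powr p / p))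
      = (\<Sum>g\<in>G. (\<Sum>e\<in>E. weight e g) * (cnorm (S g) powr p / p))"
    by (subst sum.swap) (simp only: sum_distrib_right)
  also have "(\<Sum>e\<in>E. (\<Sum>g\<in>G. weight e g) * ((p - 1) / p * cnorm (T e) powr p))
      \<le> (\<Sum>e\<in>E. (p - 1) / p * cnorm (T e) powr p)"
    using weight_row_sum assms by (intro sum_mono mult_left_le_one_le) (auto simp: sum_nonneg weight_nonneg)
  also have "(\<Sum>g\<in>G. (\<Sum>e\<in>E. weight e g) * (cnorm (S g) powr p / p)) \<le> (\<Sum>g\<in>G. cnorm (S g) powr p / p)"
    using weight_column_sum assms by (intro sum_mono mult_left_le_one_le) (auto simp: sum_nonneg weight_nonneg)
  finally show ?thesis
    by (simp add: slack_def sum_subtractf duality_pairing_overlap sum_distrib_left sum_divide_distrib)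
qed

lemma trace_young:
  assumes "1 \<le> p"
  shows "Re (duality_pairing p T E S)
    \<le> (p - 1) / p * (\<Sum>e\<in>E. cnorm (T e) powr p) + (\<Sum>g\<in>G. cnorm (S g) powr p) / p"
proof -
  have "0 \<le> (\<Sum>e\<in>E. \<Sum>g\<in>G. slack p e g)" by (intro sum_nonneg slack_nonneg assms)
  then show ?thesis using sum_slack_le[OF assms] by linarith
qed

text \<open>The slack is the sum of two nonnegative terms, the loss in Young's inequality and the loss in
  \<open>Re (overlap e g) \<le> weight e g\<close>. If both vanish, the singular values agree unless the weight is
  zero, and the mean of squares equals the product only if the two factors are conjugate.\<close>

lemma slack_zeroD:
  assumes p: "1 < p" and slack: "slack p e g = 0"
  shows "cinner e g \<noteq> 0 \<Longrightarrow> cnorm (S g) = cnorm (T e)"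
    and "T e \<noteq> 0 \<Longrightarrow> cinner (polar_vec S g) (polar_vec T e) = cnj (cinner e g)"
proof -
  define y where "y = (p - 1) / p * cnorm (T e) powr p + cnorm (S g) powr p / p"
  define q where "q = cnorm (T e) powr (p - 1) * cnorm (S g)"
  have "q \<le> y" using young_powr[of "cnorm (T e)" "cnorm (S g)" p] p by (simp add: q_def y_def)
  then have "0 \<le> weight e g * (y - q)" using weight_nonneg by simp
  moreover have "0 \<le> q * (weight e g - Re (overlap e g))"
    using overlap_le_weight by (simp add: q_def)
  moreover have "weight e g * (y - q) + q * (weight e g - Re (overlap e g)) = 0"
    using slack by (simp add: slack_def y_def q_def algebra_simps)
  ultimately have zero: "weight e g * (y - q) = 0" "q * (weight e g - Re (overlap e g)) = 0"
    by linarith+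
  have eq: "cnorm (S g) = cnorm (T e)" if "weight e g \<noteq> 0"
    using that zero(1) young_powr_eq[of "cnorm (T e)" "cnorm (S g)" p] p by (simp add: y_def q_def)
  show "cinner e g \<noteq> 0 \<Longrightarrow> cnorm (S g) = cnorm (T e)"
    by (intro eq) (simp add: weight_def add_nonneg_eq_0_iff)
  assume Te: "T e \<noteq> 0"
  show "cinner (polar_vec S g) (polar_vec T e) = cnj (cinner e g)"
  proof (cases "weight e g = 0")
    case True
    then show ?thesis by (simp add: weight_def add_nonneg_eq_0_iff)
  next
    case False
    then have "q \<noteq> 0" using eq Te by (simp add: q_def)
    then have "cinner e g - cnj (cinner (polar_vec S g) (polar_vec T e)) = 0"
      using zero(2) weight_minus_overlap[of e g] by simp
    then show ?thesis by simp
  qed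
qed

text \<open>Equality makes every slack vanish. For a singular vector \<open>e\<close> of \<open>T\<close> with singular value \<open>t\<close>, only
  those \<open>g\<close> with the same singular value then occur in the expansion of \<open>e\<close>; this computes both
  \<open>\<parallel>S e\<parallel>\<^sup>2\<close> and \<open>Re \<langle>S e, T e\<rangle>\<close> to be \<open>t\<^sup>2\<close>, so that \<open>S e - T e\<close> has norm zero.\<close>

lemma trace_young_eq:
  assumes p: "1 < p" and eq: "Re (duality_pairing p T E S)
    = (p - 1) / p * (\<Sum>e\<in>E. cnorm (T e) powr p) + (\<Sum>g\<in>G. cnorm (S g) powr p) / p"
  shows "S = T"
proof
  fix x
  have "(\<Sum>e\<in>E. \<Sum>g\<in>G. slack p e g) = 0"
    using sum_slack_le[of p] p eq by (intro antisym sum_nonneg slack_nonneg) auto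
  then have slack: "slack p e g = 0" if "e \<in> E" "g \<in> G" for e g
    using that p slack_nonneg finiteE finiteG
    by (simp add: sum_nonneg_eq_0_iff sum_nonneg)
  have "S e = T e" if e: "e \<in> E" for e
  proof -
    define t where "t = cnorm (T e)"
    have s: "cnorm (S g) = t" if "g \<in> G" "cinner e g \<noteq> 0" for g
      using slack_zeroD(1)[OF p slack[OF e that(1)] that(2)] by (simp add: t_def)
    have unit: "(\<Sum>g\<in>G. (cmod (cinner e g))\<^sup>2) = 1"
      by (simp add: parseval_cnorm[OF basisG] orthonormal_basis_cnorm[OF basisE e])
    have "(cnorm (S e))\<^sup>2 = (\<Sum>g\<in>G. (cmod (cinner e g))\<^sup>2 * (cnorm (S g))\<^sup>2)"
      by (subst clinear_basis_expansion[OF basisG linS])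
        (intro cnorm_sum_orthogonal singular_basis_orthogonal[OF G])
    also have "\<dots> = (\<Sum>g\<in>G. (cmod (cinner e g))\<^sup>2 * t\<^sup>2)"
      using s by (intro sum.cong) auto
    finally have norm_S: "(cnorm (S e))\<^sup>2 = t\<^sup>2" using unit by (simp flip: sum_distrib_right)
    have "Re (cinner (S e) (T e)) = (\<Sum>g\<in>G. t * cnorm (S g) * Re (overlap e g))"
      by (simp add: cinner_matrix_entry t_def)
    also have "\<dots> = (\<Sum>g\<in>G. t\<^sup>2 * (cmod (cinner e g))\<^sup>2)"
    proof (intro sum.cong refl)
      fix g assume g: "g \<in> G"
      show "t * cnorm (S g) * Re (overlap e g) = t\<^sup>2 * (cmod (cinner e g))\<^sup>2"
      proof (cases "t = 0 \<or> cinner e g = 0")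
        case True
        then show ?thesis by (auto simp: overlap_def)
      next
        case False
        then have "overlap e g = complex_of_real ((cmod (cinner e g))\<^sup>2)"
          using slack_zeroD(2)[OF p slack[OF e g]]
          by (simp add: overlap_def t_def complex_norm_square del: of_real_power)
        then show ?thesis using s[OF g] False by (simp add: power2_eq_square)
      qed
    qed
    finally have "Re (cinner (S e) (T e)) = t\<^sup>2" using unit by (simp flip: sum_distrib_left)
    then have "(cnorm (S e - T e))\<^sup>2 = 0"
      using norm_S by (simp add: cnorm_diff_square t_def)
    then show ?thesis by simp
  qed
  then show "S x = T x" by (rule clinear_eq_on_basis[OF basisE linS linT])
qed

end

section \<open>Hoelder's inequality and the triangle inequality\<close>

lemma duality_pairing_zero: "duality_pairing p (\<lambda>x. 0) E S = 0" "duality_pairing p T E (\<lambda>x. 0) = 0"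
  by (simp_all add: duality_pairing_def)

text \<open>Hoelder's inequality is Young's inequality for the operators scaled to norm one, where
  \<open>(p - 1) / p + 1 / p = 1\<close>. For \<open>p > 1\<close> the equality case of the latter says that the scaled
  operators coincide.\<close>

lemma
  assumes T: "clinear T" "singular_basis T E" and S: "clinear S" and p: "1 \<le> p"
  shows trace_hoelder:
      "Re (duality_pairing p T E S) \<le> schatten_norm p T powr (p - 1) * schatten_norm p S"
    and trace_hoelder_eq:
      "\<lbrakk>1 < p; schatten_norm p T \<noteq> 0; schatten_norm p S \<noteq> 0;
        Re (duality_pairing p T E S) = schatten_norm p T powr (p - 1) * schatten_norm p S\<rbrakk>
       \<Longrightarrow> complex_of_real (1 / schatten_norm p S) *\<^sub>C S x
           = complex_of_real (1 / schatten_norm p T) *\<^sub>C T x"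
proof -
  define n m where "n = schatten_norm p T" and "m = schatten_norm p S"
  define T' S' where "T' = (\<lambda>x. complex_of_real (1 / n) *\<^sub>C T x)"
    and "S' = (\<lambda>x. complex_of_real (1 / m) *\<^sub>C S x)"
  obtain G where G: "singular_basis S G" using singular_basis_exists[OF S] .
  have lin': "clinear T'" "clinear S'"
    unfolding T'_def S'_def by (intro clinear_scaled T S)+
  have bas': "singular_basis T' E" "singular_basis S' G"
    unfolding T'_def S'_def by (intro singular_basis_scaleC T G)+
  interpret singular_pair T' S' E G
    by (intro singular_pair.intro lin' bas')
  have unit: "(\<Sum>e\<in>E. cnorm (T' e) powr p) = 1" "(\<Sum>g\<in>G. cnorm (S' g) powr p) = 1"
    if "0 < n" "0 < m"
  proof -
    have "schatten_norm p T' = 1" "schatten_norm p S' = 1"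
      unfolding T'_def S'_def schatten_norm_scaleC[OF T(1) p] schatten_norm_scaleC[OF S p]
      using that by (simp_all add: norm_divide n_def[symmetric] m_def[symmetric])
    then show "(\<Sum>e\<in>E. cnorm (T' e) powr p) = 1" "(\<Sum>g\<in>G. cnorm (S' g) powr p) = 1"
      using schatten_norm_powr[OF lin'(1) bas'(1) p] schatten_norm_powr[OF lin'(2) bas'(2) p] by simp_all
  qed
  have pairing': "Re (duality_pairing p T' E S') = Re (duality_pairing p T E S) / (n powr (p - 1) * m)"
    if "0 < n" "0 < m"
    using that unfolding T'_def S'_def
    by (simp add: duality_pairing_scale_left duality_pairing_scaleC_right powr_divide mult.commute
        del: of_real_divide)
  have weights: "(p - 1) / p * 1 + 1 / p = 1" using p by (simp add: field_simps)
  show "Re (duality_pairing p T E S) \<le> n powr (p - 1) * m"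
  proof (cases "n = 0 \<or> m = 0")
    case True
    then have "T = (\<lambda>x. 0) \<or> S = (\<lambda>x. 0)"
      using schatten_norm_eq_0[OF T(1) p] schatten_norm_eq_0[OF S p] by (simp add: n_def m_def)
    then show ?thesis using True by (auto simp: duality_pairing_zero)
  next
    case False
    then have pos: "0 < n" "0 < m"
      using schatten_norm_nonneg[of p T] schatten_norm_nonneg[of p S] by (auto simp: n_def m_def)
    have "Re (duality_pairing p T E S) / (n powr (p - 1) * m) \<le> 1"
      using trace_young[OF p] unfolding pairing'[OF pos] unit[OF pos] weights .
    then show ?thesis using pos by (simp add: divide_le_eq)
  qed
  assume eq: "1 < p" "schatten_norm p T \<noteq> 0" "schatten_norm p S \<noteq> 0"
    "Re (duality_pairing p T E S) = schatten_norm p T powr (p - 1) * schatten_norm p S"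
  have pos: "0 < n" "0 < m"
    using eq(2,3) schatten_norm_nonneg[of p T] schatten_norm_nonneg[of p S] by (auto simp: n_def m_def)
  have "S' = T'"
  proof (rule trace_young_eq[OF eq(1)])
    show "Re (duality_pairing p T' E S')
        = (p - 1) / p * (\<Sum>e\<in>E. cnorm (T' e) powr p) + (\<Sum>g\<in>G. cnorm (S' g) powr p) / p"
      unfolding pairing'[OF pos] unit[OF pos] weights
      using eq(4) pos by (simp flip: n_def m_def)
  qed
  then show "complex_of_real (1 / m) *\<^sub>C S x = complex_of_real (1 / n) *\<^sub>C T x"
    unfolding S'_def T'_def by (rule fun_cong)
qed

lemma rotate_to_modulus:
  obtains c where "cmod c = 1" "c * z = complex_of_real (cmod z)"
proof (cases "z = 0")
  case True
  then show ?thesis using that[of 1] by simp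
next
  case False
  then have "cnj z / complex_of_real (cmod z) * z = complex_of_real (cmod z)"
    using complex_norm_square[of z] by (simp add: field_simps power2_eq_square)
  then show ?thesis using that[of "cnj z / complex_of_real (cmod z)"] False by (simp add: norm_divide)
qed

lemma trace_hoelder_rotated:
  assumes "clinear T" "singular_basis T E" "clinear S" "1 \<le> p" "cmod c = 1"
  shows "Re (c * duality_pairing p T E S) \<le> schatten_norm p T powr (p - 1) * schatten_norm p S"
  using trace_hoelder[OF assms(1,2) clinear_scaled[OF assms(3)] assms(4), of c] assms(5)
  by (simp add: duality_pairing_scaleC_right schatten_norm_scaleC[OF assms(3,4)])

lemma trace_hoelder_cmod:
  assumes "clinear T" "singular_basis T E" "clinear S" "1 \<le> p"
  shows "cmod (duality_pairing p T E S) \<le> schatten_norm p T powr (p - 1) * schatten_norm p S"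
proof -
  obtain c where "cmod c = 1"
    "c * duality_pairing p T E S = complex_of_real (cmod (duality_pairing p T E S))"
    by (rule rotate_to_modulus)
  then show ?thesis using trace_hoelder_rotated[OF assms, of c] by simp
qed

text \<open>Pairing \<open>R = T + c S\<close> with itself gives \<open>\<parallel>R\<parallel>\<^sup>p\<close>, and the pairing is additive in its last
  argument. Hoelder's inequality bounds the two summands separately, so that this identity yields
  the triangle inequality and shows what equality in it means.\<close>

lemma duality_pairing_sum:
  fixes T S :: "'h::fd_complex_hilbert \<Rightarrow> 'h"
  defines "R \<equiv> \<lambda>c x. T x + c *\<^sub>C S x"
  assumes lin: "clinear T" "clinear S" and F: "singular_basis (R c) F" and p: "1 \<le> p"
  shows "schatten_norm p (R c) powr (p - 1) * schatten_norm p (R c)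
    = Re (duality_pairing p (R c) F T) + Re (c * duality_pairing p (R c) F S)"
proof -
  have linR: "clinear (R c)" unfolding R_def by (intro clinear_add_scaleC lin)
  have "Re (duality_pairing p (R c) F (R c)) = schatten_norm p (R c) powr p"
    using duality_pairing_self[OF linR F p] by simp
  moreover have "duality_pairing p (R c) F (R c)
      = duality_pairing p (R c) F T + c * duality_pairing p (R c) F S"
    by (subst (2) R_def) (rule duality_pairing_add)
  ultimately show ?thesis
    using powr_mult_base[OF schatten_norm_nonneg, of p "R c" "p - 1"] by (simp add: mult.commute)
qed

lemma schatten_norm_triangle:
  assumes lin: "clinear T" "clinear S" and p: "1 \<le> p" and c: "cmod c = 1"
  shows "schatten_norm p (\<lambda>x. T x + c *\<^sub>C S x) \<le> schatten_norm p T + schatten_norm p S"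
proof -
  define R where "R = (\<lambda>x. T x + c *\<^sub>C S x)"
  have linR: "clinear R" unfolding R_def by (intro clinear_add_scaleC lin)
  obtain F where F: "singular_basis R F" using singular_basis_exists[OF linR] .
  show ?thesis
  proof (cases "schatten_norm p R = 0")
    case True
    then show ?thesis using schatten_norm_nonneg[of p T] schatten_norm_nonneg[of p S] by (simp add: R_def)
  next
    case False
    then have "0 < schatten_norm p R powr (p - 1)" by simp
    moreover have "schatten_norm p R powr (p - 1) * schatten_norm p R
        \<le> schatten_norm p R powr (p - 1) * (schatten_norm p T + schatten_norm p S)"
      using duality_pairing_sum[OF lin F[unfolded R_def] p, folded R_def]
        trace_hoelder[OF linR F lin(1) p] trace_hoelder_rotated[OF linR F lin(2) p c]
      by (simp add: distrib_left)
    ultimately show ?thesis by (simp add: R_def)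
  qed
qed

section \<open>Polar factors and the trace norm\<close>

text \<open>The partial isometry of the polar decomposition, constructed from a singular basis.\<close>

definition polar_op :: "('h::fd_complex_hilbert \<Rightarrow> 'h) \<Rightarrow> 'h set \<Rightarrow> 'h \<Rightarrow> 'h"
  where "polar_op T E x = (\<Sum>e\<in>E. cinner x e *\<^sub>C polar_vec T e)"

lemma clinear_polar_op: "clinear (polar_op T E)"
  by (intro clinearI) (simp_all add: polar_op_def cinner_add_left cinner_scaleC_left scaleC_add_left
      sum.distrib complex_vector.scale_sum_right scaleC_scaleC)

lemma polar_op_basis:
  assumes "orthonormal_basis E" "e \<in> E"
  shows "polar_op T E e = polar_vec T e"
proof -
  have "polar_op T E e = (\<Sum>x\<in>E. if x = e then polar_vec T e else 0)"
    unfolding polar_op_def using assms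
    by (intro sum.cong) (auto simp: orthonormal_basis_def scaleC_one)
  then show ?thesis using assms orthonormal_basis_finite[OF assms(1)] by simp
qed

lemma cnorm_polar_op_le:
  assumes "singular_basis T E"
  shows "cnorm (polar_op T E x) \<le> cnorm x"
proof -
  have "(cnorm (polar_op T E x))\<^sup>2 = (\<Sum>e\<in>E. (cmod (cinner x e))\<^sup>2 * (cnorm (polar_vec T e))\<^sup>2)"
    unfolding polar_op_def by (intro cnorm_sum_orthogonal polar_vec_orthogonal[OF assms])
  also have "\<dots> \<le> (\<Sum>e\<in>E. (cmod (cinner x e))\<^sup>2)"
    by (intro sum_mono mult_left_le) (auto simp: cnorm_polar_vec)
  also have "\<dots> = (cnorm x)\<^sup>2"
    by (rule parseval_cnorm[OF singular_basis_orthonormal[OF assms]])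
  finally show ?thesis by (rule power2_le_imp_le) simp
qed

text \<open>For \<open>p = 1\<close> the pairing is \<open>tr (W\<^sup>*S)\<close> with the polar factor \<open>W\<close>, so that it can be computed in
  any basis, in particular in one adapted to another operator.\<close>

lemma duality_pairing_one:
  assumes E: "singular_basis T E" and S: "clinear S" and F: "orthonormal_basis F"
  shows "duality_pairing 1 T E S = (\<Sum>f\<in>F. cinner (S f) (polar_op T E f))"
proof -
  note E' = singular_basis_orthonormal[OF E]
  have "cnorm (T e) powr (1 - 2) = 1 / cnorm (T e)" for e
    by (cases "T e = 0") (simp_all add: powr_minus_divide)
  then have "duality_pairing 1 T E S = (\<Sum>e\<in>E. cinner (S e) (polar_op T E e))"
    unfolding duality_pairing_def
    by (intro sum.cong refl) (simp add: polar_op_basis[OF E'] polar_vec_def cinner_scaleC_right)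
  also have "\<dots> = (\<Sum>f\<in>F. cinner (S f) (polar_op T E f))"
    by (rule sum_cinner_basis_independent[OF E' F S clinear_polar_op])
  finally show ?thesis .
qed

text \<open>With \<open>W\<close> the polar factor of \<open>R\<close>, the hypothesis says that \<open>Re (tr (W\<^sup>*T))\<close> attains the trace norm
  of \<open>T\<close>. In the singular basis of \<open>T\<close> this sum is \<open>\<Sum>e\<in>E. t Re \<langle>f, W e\<rangle>\<close>, where \<open>t\<close> is the
  singular value and \<open>f\<close> the unit left singular vector of \<open>e\<close>. As \<open>W\<close> is a contraction, each term
  is at most \<open>t\<close>, and equality forces \<open>W e = f\<close> because \<open>t\<close> is positive. It is here that \<open>T\<close> has to
  be injective: the trace does not see the values of \<open>W\<close> on the kernel of \<open>T\<close>.\<close>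

lemma polar_op_unique:
  assumes T: "clinear T" "singular_basis T E" and nz: "\<And>e. e \<in> E \<Longrightarrow> T e \<noteq> 0"
    and F: "singular_basis R F"
    and eq: "Re (duality_pairing 1 R F T) = schatten_norm 1 T"
  shows "polar_op R F x = polar_op T E x"
proof -
  note E = singular_basis_orthonormal[OF T(2)]
  define d where "d e = (cnorm (polar_vec T e - polar_op R F e))\<^sup>2" for e
  have term_le: "cnorm (T e) * d e \<le> 2 * (cnorm (T e) - Re (cinner (T e) (polar_op R F e)))"
    if e: "e \<in> E" for e
  proof -
    have "cnorm (polar_op R F e) \<le> 1"
      using cnorm_polar_op_le[OF F, of e] orthonormal_basis_cnorm[OF E e] by simp
    then have "d e \<le> 2 - 2 * Re (cinner (polar_vec T e) (polar_op R F e))"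
      unfolding d_def cnorm_diff_square using nz[OF e] by (simp add: cnorm_polar_vec power_le_one)
    then have "cnorm (T e) * d e
        \<le> cnorm (T e) * (2 - 2 * Re (cinner (polar_vec T e) (polar_op R F e)))"
      by (intro mult_left_mono) auto
    also have "\<dots> = 2 * (cnorm (T e) - Re (cinner (T e) (polar_op R F e)))"
      by (subst (3) scale_polar_vec) (simp add: cinner_scaleC_left algebra_simps)
    finally show ?thesis .
  qed
  have "(\<Sum>e\<in>E. cnorm (T e)) = Re (\<Sum>e\<in>E. cinner (T e) (polar_op R F e))"
    using schatten_norm_powr[OF T, of 1] eq unfolding duality_pairing_one[OF F T(1) E]
    by (simp add: schatten_norm_nonneg)
  then have "(\<Sum>e\<in>E. 2 * (cnorm (T e) - Re (cinner (T e) (polar_op R F e)))) = 0"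
    by (simp add: sum_subtractf flip: sum_distrib_left)
  then have "(\<Sum>e\<in>E. cnorm (T e) * d e) = 0"
    using sum_mono[of E "\<lambda>e. cnorm (T e) * d e", OF term_le]
    by (intro antisym sum_nonneg) (auto simp: d_def)
  then have "\<forall>e\<in>E. d e = 0"
    using nz by (subst (asm) sum_nonneg_eq_0_iff) (auto simp: d_def orthonormal_basis_finite[OF E])
  then have "polar_op R F e = polar_op T E e" if "e \<in> E" for e
    using that by (simp add: d_def polar_op_basis[OF E])
  then show ?thesis
    by (rule clinear_eq_on_basis[OF E clinear_polar_op clinear_polar_op])
qed

section \<open>Norm-parallel operators\<close>

text \<open>If \<open>\<parallel>T + c S\<parallel> = \<parallel>T\<parallel> + \<parallel>S\<parallel>\<close> and \<open>R = T + c S\<close>, then pairing \<open>R\<close> with \<open>T\<close> and with \<open>c S\<close> gives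
  equality in Hoelder's inequality twice. For \<open>p > 1\<close> both operators are therefore positive
  multiples of \<open>R\<close>, hence of each other, and the pairing of \<open>T\<close> with \<open>S\<close> can be computed. For
  \<open>p = 1\<close> the operators \<open>R\<close> and \<open>T\<close> have the same polar factor, so that the equality for \<open>R\<close> and
  \<open>S\<close> is one for \<open>T\<close> and \<open>S\<close>.\<close>

lemma parallel_imp_trace_eq:
  assumes T: "clinear T" "singular_basis T E" and S: "clinear S"
    and p: "1 < p \<or> (p = 1 \<and> bij T)"
    and par: "schatten_parallel p T S"
  shows "schatten_norm p T * cmod (duality_pairing p T E S) = schatten_norm p S * schatten_norm p T powr p"
proof -
  define n m where "n = schatten_norm p T" and "m = schatten_norm p S"
  have p1: "1 \<le> p" using p by auto
  have nonneg: "0 \<le> n" "0 \<le> m" by (simp_all add: n_def m_def schatten_norm_nonneg)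
  consider "n = 0" | "m = 0" | "0 < n" "0 < m" using nonneg by linarith
  then have "n * cmod (duality_pairing p T E S) = m * n powr p"
  proof cases
    case 2
    then have "S = (\<lambda>x. 0)" using schatten_norm_eq_0[OF S p1] by (simp add: m_def)
    then show ?thesis using 2 by (simp add: duality_pairing_zero)
  next
    case 3
    obtain c where c: "cmod c = 1" and sum: "schatten_norm p (\<lambda>x. T x + c *\<^sub>C S x) = n + m"
      using par by (auto simp: schatten_parallel_def n_def m_def)
    define R where "R = (\<lambda>x. T x + c *\<^sub>C S x)"
    have linR: "clinear R" unfolding R_def by (intro clinear_add_scaleC T S)
    obtain F where F: "singular_basis R F" using singular_basis_exists[OF linR] .
    define k where "k = schatten_norm p R"
    have k: "k = n + m" using sum by (simp add: k_def R_def)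
    have "k powr (p - 1) * k = Re (duality_pairing p R F T) + Re (c * duality_pairing p R F S)"
      using duality_pairing_sum[OF T(1) S F[unfolded R_def] p1] by (simp add: k_def R_def)
    moreover have "Re (duality_pairing p R F T) \<le> k powr (p - 1) * n"
      using trace_hoelder[OF linR F T(1) p1] by (simp add: k_def n_def)
    moreover have "Re (c * duality_pairing p R F S) \<le> k powr (p - 1) * m"
      using trace_hoelder_rotated[OF linR F S p1 c] by (simp add: k_def m_def)
    ultimately have eqT: "Re (duality_pairing p R F T) = k powr (p - 1) * n"
      and eqS: "Re (c * duality_pairing p R F S) = k powr (p - 1) * m"
      by (simp_all add: k distrib_left)
    show ?thesis
      using p
    proof
      assume p: "1 < p"
      have knz: "schatten_norm p R \<noteq> 0" using k 3 by (simp add: k_def)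
      define S' where "S' = (\<lambda>x. c *\<^sub>C S x)"
      have linS': "clinear S'" unfolding S'_def by (rule clinear_scaled[OF S])
      have normS': "schatten_norm p S' = m"
        unfolding S'_def schatten_norm_scaleC[OF S p1] by (simp add: c m_def)
      have eqS': "Re (duality_pairing p R F S') = schatten_norm p R powr (p - 1) * schatten_norm p S'"
        unfolding normS' unfolding S'_def duality_pairing_scaleC_right using eqS by (simp add: k_def)
      have "complex_of_real (1 / n) *\<^sub>C T x = complex_of_real (1 / k) *\<^sub>C R x" for x
        using trace_hoelder_eq[OF linR F T(1) p1 p knz] 3(1) eqT by (simp add: n_def k_def)
      moreover have "complex_of_real (1 / m) *\<^sub>C S' x = complex_of_real (1 / k) *\<^sub>C R x" for x
        using trace_hoelder_eq[OF linR F linS' p1 p knz _ eqS'] 3(2) by (simp add: normS' k_def)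
      ultimately have proportional: "complex_of_real (1 / m) *\<^sub>C S' x = complex_of_real (1 / n) *\<^sub>C T x" for x
        by simp
      have "S' x = complex_of_real (m / n) *\<^sub>C T x" for x
        using arg_cong[OF proportional[of x], of "\<lambda>y. complex_of_real m *\<^sub>C y"] 3
        by (simp add: scaleC_scaleC scaleC_one)
      then have "c * duality_pairing p T E S = complex_of_real (m / n) * duality_pairing p T E T"
        unfolding duality_pairing_scaleC_right[symmetric] S'_def by simp
      also have "\<dots> = complex_of_real (m / n * n powr p)"
        by (simp add: duality_pairing_self[OF T p1] n_def)
      finally have "cmod (c * duality_pairing p T E S) = m / n * n powr p"
        using 3 by (simp only: norm_of_real) simp
      then show ?thesis using c 3 by (simp add: norm_mult)
    next
      assume p: "p = 1 \<and> bij T"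
      have nz: "T e \<noteq> 0" if "e \<in> E" for e
      proof
        assume "T e = 0"
        then have "e = 0" using p clinear_zero[OF T(1)] by (metis bij_is_inj injD)
        then show False
          using orthonormal_basis_cnorm[OF singular_basis_orthonormal[OF T(2)] that] by simp
      qed
      have "Re (duality_pairing 1 R F T) = schatten_norm 1 T"
        using eqT p k 3 by (simp add: n_def)
      then have "polar_op R F x = polar_op T E x" for x
        using polar_op_unique[OF T _ F] nz by blast
      then have "duality_pairing 1 T E S = duality_pairing 1 R F S"
        using duality_pairing_one[OF T(2) S singular_basis_orthonormal[OF T(2)]]
          duality_pairing_one[OF F S singular_basis_orthonormal[OF T(2)]] by simp
      then have "m \<le> cmod (duality_pairing p T E S)"
        using eqS p k 3 complex_Re_le_cmod[of "c * duality_pairing p T E S"] c by (simp add: norm_mult)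
      moreover have "cmod (duality_pairing p T E S) \<le> m"
        using trace_hoelder_cmod[OF T S p1] p 3 by (simp add: n_def m_def)
      ultimately show ?thesis using p 3 by simp
    qed
  qed simp
  then show ?thesis by (simp add: n_def m_def)
qed

text \<open>Choose the unimodular \<open>c\<close> that makes the pairing of \<open>T\<close> with \<open>c S\<close> nonnegative. Then \<open>T + c S\<close>
  pairs with \<open>T\<close> to \<open>\<parallel>T\<parallel>\<^bsup>p-1\<^esup> (\<parallel>T\<parallel> + \<parallel>S\<parallel>)\<close>, and Hoelder's inequality bounds \<open>\<parallel>T + c S\<parallel>\<close>
  from below.\<close>

lemma trace_eq_imp_parallel:
  assumes T: "clinear T" "singular_basis T E" and S: "clinear S" and p: "1 \<le> p"
    and eq: "schatten_norm p T * cmod (duality_pairing p T E S) = schatten_norm p S * schatten_norm p T powr p"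
  shows "schatten_parallel p T S"
proof -
  define n m where "n = schatten_norm p T" and "m = schatten_norm p S"
  show ?thesis
  proof (cases "n = 0")
    case True
    then have "T = (\<lambda>x. 0)" using schatten_norm_eq_0[OF T(1) p] by (simp add: n_def)
    then show ?thesis using True
      by (auto simp: schatten_parallel_def n_def scaleC_one intro!: exI[of _ 1])
  next
    case False
    then have n: "0 < n" using schatten_norm_nonneg[of p T] by (simp add: n_def)
    have np: "n powr p = n * n powr (p - 1)" using n powr_mult_base[of n "p - 1"] by simp
    obtain c where c: "cmod c = 1"
      "c * duality_pairing p T E S = complex_of_real (cmod (duality_pairing p T E S))"
      by (rule rotate_to_modulus)
    define R where "R = (\<lambda>x. T x + c *\<^sub>C S x)"
    have linR: "clinear R" unfolding R_def by (intro clinear_add_scaleC T S)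
    have "cmod (duality_pairing p T E S) = n powr (p - 1) * m"
      using eq n np by (simp add: n_def m_def)
    then have "n powr (p - 1) * (n + m) = Re (duality_pairing p T E R)"
      unfolding R_def duality_pairing_add c(2) duality_pairing_self[OF T p]
      using np by (simp add: algebra_simps n_def)
    also have "\<dots> \<le> n powr (p - 1) * schatten_norm p R"
      using trace_hoelder[OF T linR p] by (simp add: n_def)
    finally have "n + m \<le> schatten_norm p R" using n by simp
    moreover have "schatten_norm p R \<le> n + m"
      unfolding R_def n_def m_def by (rule schatten_norm_triangle[OF T(1) S p c(1)])
    ultimately show ?thesis
      using c(1) by (auto simp: schatten_parallel_def R_def n_def m_def intro!: exI[of _ c])
  qed
qed

lemma parallel_iff_polar_trace:
  assumes T: "clinear T" and S: "clinear S" and U: "polar_decomposition T U"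
    and p: "1 < p \<or> (p = 1 \<and> bij T)"
  shows "schatten_parallel p T S \<longleftrightarrow>
    complex_of_real (schatten_norm p T *
      cmod (ctrace (op_powr (op_abs T) (p - 1) \<circ> cadjoint U \<circ> S)))
    = complex_of_real (schatten_norm p S) * ctrace (op_powr (op_abs T) p)"
proof -
  have p1: "1 \<le> p" using p by auto
  obtain E where E: "singular_basis T E" using singular_basis_exists[OF T] .
  have "schatten_parallel p T S \<longleftrightarrow>
      schatten_norm p T * cmod (duality_pairing p T E S) = schatten_norm p S * schatten_norm p T powr p"
    using parallel_imp_trace_eq[OF T E S p] trace_eq_imp_parallel[OF T E S p1] by blast
  then show ?thesis
    unfolding ctrace_polar_dual[OF T E S U p] ctrace_op_powr_op_abs[OF T E]
      schatten_norm_powr[OF T E p1, symmetric] of_real_mult[symmetric] of_real_eq_iff .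
qed

lemma schatten_parallel_sym:
  assumes T: "clinear T" and S: "clinear S" and p: "1 \<le> p" and par: "schatten_parallel p T S"
  shows "schatten_parallel p S T"
proof -
  obtain c where c: "cmod c = 1"
    and sum: "schatten_norm p (\<lambda>x. T x + c *\<^sub>C S x) = schatten_norm p T + schatten_norm p S"
    using par by (auto simp: schatten_parallel_def)
  have "cnj c * c = 1" using c complex_norm_square[of c] by (simp add: mult.commute)
  then have "(\<lambda>x. S x + cnj c *\<^sub>C T x) = (\<lambda>x. cnj c *\<^sub>C (T x + c *\<^sub>C S x))"
    by (simp add: scaleC_add_right scaleC_scaleC scaleC_one add.commute)
  then have "schatten_norm p (\<lambda>x. S x + cnj c *\<^sub>C T x) = schatten_norm p S + schatten_norm p T"
    using schatten_norm_scaleC[OF clinear_add_scaleC[OF T S] p, of "cnj c" c] c sum by simp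
  then show ?thesis unfolding schatten_parallel_def using c by (intro exI[of _ "cnj c"]) simp
qed

theorem proposition2p19:
  fixes T S U V :: "'h::fd_complex_hilbert \<Rightarrow> 'h" and p :: real
  assumes "clinear T" and "clinear S"
    and "polar_decomposition T U" and "polar_decomposition S V"
    and "1 < p \<or> (p = 1 \<and> bij T \<and> bij S)"
  shows "(schatten_parallel p T S \<longleftrightarrow>
           complex_of_real (schatten_norm p T *
             cmod (ctrace (op_powr (op_abs T) (p - 1) \<circ> cadjoint U \<circ> S)))
           = complex_of_real (schatten_norm p S) * ctrace (op_powr (op_abs T) p))
       \<and> (schatten_parallel p T S \<longleftrightarrow>
           complex_of_real (schatten_norm p S *
             cmod (ctrace (op_powr (op_abs S) (p - 1) \<circ> cadjoint V \<circ> T)))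
           = complex_of_real (schatten_norm p T) * ctrace (op_powr (op_abs S) p))"
proof -
  have p: "1 \<le> p" "1 < p \<or> (p = 1 \<and> bij T)" "1 < p \<or> (p = 1 \<and> bij S)"
    using assms(5) by auto
  have "schatten_parallel p T S \<longleftrightarrow> schatten_parallel p S T"
    using schatten_parallel_sym assms(1,2) p(1) by blast
  then show ?thesis
    using parallel_iff_polar_trace[OF assms(1,2,3) p(2)] parallel_iff_polar_trace[OF assms(2,1,4) p(3)]
    by blast
qed

end
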